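(* Let $0\le n\le 12$. If there exists a (Class 1--4) horizontal model over the Hirzebruch surface $\mathbb{F}_n$ that is of Type III.b, i.e. whose open-chain resolution has central fiber $Y_0=\bigcup_{p=0}^P Y^p$ with $P\ge1$ and generic elliptic fibers of Kodaira type $\mathrm{I}_{n_p}$ with $n_p>0$ over every base component $B^p$, $0\le p\le P$, then $0\le n\le 4$.
   Context: All varieties are over $\mathbb{C}$ and $D\subset\mathbb{C}$ is an open disk with coordinate $u$. The Hirzebruch surface $\mathbb{F}_n$ is a $\mathbb{P}^1$-bundle over $\mathbb{P}^1$, with fiber class $f$, a section $h$ with $h\cdot h=-n$, $h\cdot f=1$, and sections in the class $h+nf$ (self-intersection $+n$). A horizontal model over $\mathbb{F}_n$ is a degeneration $\hat\rho:\hat{\mathcal{Y}}\to D$ of Calabi-Yau threefolds given by a Weierstrass model $y^2=x^3+fxz^4+gz^6$ over $\hat{\mathcal{B}}=\mathbb{F}_n\times D$, with discriminant $\Delta=4f^3+27g^2$, such that the non-minimal elliptic fibers in codimension one of the central base $\mathbb{F}_n\times\{0\}$ (vanishing orders of $(f,g,\Delta)$ at least $(4,6,12)$) lie over $h$, over a curve in the class $h+nf$, or over both. It is of Class 1--4 if along each non-minimal curve the orders of vanishing on the family satisfy $\mathrm{ord}(f)\le 4$ or $\mathrm{ord}(g)\le 6$ (i.e. the non-minimality bound is saturated by at least one of them). Its open-chain resolution $\rho:\mathcal{Y}\to D$ is obtained by base change $u\mapsto u^k$, successive blow-ups of the base along the non-minimal curves, and division of $(f,g,\Delta)$ by the appropriate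 powers $(4,6,12)$ of the exceptional coordinates. It is a Weierstrass model with polynomials $f,g,\Delta$ over a smooth threefold $\mathcal{B}$ fibered over $D$, with the following properties. (1) The fiber of $\mathcal{B}$ over $0$ is a reduced chain $B_0=\bigcup_{p=0}^P B^p$ with $B^p\cong\mathbb{F}_n$. Write $S_p$, $T_p=S_p+nV_p$, $V_p$ for the classes of the $(-n)$-curve, the $(+n)$-curves and the fiber in $B^p$. For $0\le p\le P-1$, $B^p\cap B^{p+1}$ is the $(-n)$-curve in $B^p$ and a $(+n)$-curve in $B^{p+1}$; non-adjacent components are disjoint. (2) Let $f_p=f|_{B^p}$ and $g_p=g|_{B^p}$. For $P\ge1$ these are sections of $\mathcal{L}_p^{\otimes4}$ and $\mathcal{L}_p^{\otimes6}$, where $\mathcal{L}_0=S_0+(2+n)V_0$, $\mathcal{L}_p=2V_p$ for $1\le p\le P-1$, and $\mathcal{L}_P=S_P+2V_P$. The elliptic fiber over the generic point of $B^p$ is of Kodaira type $\mathrm{I}_{n_p}$ with $n_p\ge0$: $\Delta$ vanishes to order exactly $n_p$ along $B^p$, and if $n_p>0$ then neither $f_p$ nor $g_p$ is identically zero (while $4f_p^3+27g_p^2\equiv 0$ on $B^p$). (3) The central fiber is free of (possibly obscured) infinite-distance non-minimal singularities: there is no irreducible curve $C\subset B^p$, for any $p$, along which $f_p$ vanishes to order at least $4$ and $g_p$ vanishes to order at least $6$ (component vanishing orders). *)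

theory Defs
  imports "HOL-Complex_Analysis.Complex_Analysis"
begin

text \<open>
  All spaces are toric, and are handled through homogeneous (Cox) coordinates: sections of line
  bundles are functions of the homogeneous coordinates, curves are zero loci of irreducible
  homogeneous polynomials.

  On \<open>F_n\<close> the coordinates \<open>Cs, Ct, Cv, Cw\<close> have classes \<open>h, h + nf, f, f\<close>, so \<open>Cs = 0\<close> is the
  \<open>(-n)\<close>-curve \<open>h\<close>.  On \<open>F_n \<times> D\<close> the coordinate \<open>Ce 0\<close> is the coordinate \<open>u\<close> of \<open>D\<close>.
  On a chain of components indexed by \<open>lo \<le> p \<le> hi\<close>, the component \<open>p\<close> is \<open>Ce p = 0\<close> and
  \<open>u\<close> is the product of all \<open>Ce p\<close>.  Index \<open>0\<close> is the strict transform of \<open>F_n \<times> {0}\<close>; the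
  components created over \<open>h\<close> get the indices \<open>1, 2, ...\<close>, those over a curve in the class
  \<open>h + nf\<close> get \<open>-1, -2, ...\<close>.  Thus index \<open>lo + p\<close> corresponds to \<open>B^p\<close> and \<open>P = hi - lo\<close>.
  Coordinates \<open>Ce p\<close> outside \<open>lo..hi\<close> are never used.
\<close>

datatype coord = Cs | Ct | Cv | Cw | Ce int

type_synonym point = "coord \<Rightarrow> complex"

section \<open>Sections and curves on Hirzebruch surfaces\<close>

text \<open>Exponents of the monomials in the class \<open>a h + b f\<close>.\<close>

definition monomials :: "nat \<Rightarrow> nat \<Rightarrow> nat \<Rightarrow> (nat \<times> nat \<times> nat \<times> nat) set" where
  "monomials n a b = {(i, j, k, l). i + j = a \<and> n * j + k + l = b}"

lemma finite_monomials: "finite (monomials n a b)"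
proof (rule finite_subset)
  show "monomials n a b \<subseteq> {..a} \<times> {..a} \<times> {..b} \<times> {..b}"
    by (auto simp: monomials_def)
qed simp

definition sections :: "nat \<Rightarrow> nat \<Rightarrow> nat \<Rightarrow> (point \<Rightarrow> complex) set" where
  "sections n a b =
     {F. \<exists>c :: nat \<Rightarrow> nat \<Rightarrow> nat \<Rightarrow> nat \<Rightarrow> complex. F = (\<lambda>x. \<Sum>(i, j, k, l)\<in>monomials n a b.
           c i j k l * x Cs ^ i * x Ct ^ j * x Cv ^ k * x Cw ^ l)}"

text \<open>Sections over \<open>F_n \<times> D\<close> of the pullback of the line bundle of class \<open>a h + b f\<close>.\<close>

definition family_sections :: "nat \<Rightarrow> complex set \<Rightarrow> nat \<Rightarrow> nat \<Rightarrow> (point \<Rightarrow> complex) set" where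
  "family_sections n D a b =
     {F. \<exists>c :: nat \<Rightarrow> nat \<Rightarrow> nat \<Rightarrow> nat \<Rightarrow> complex \<Rightarrow> complex.
           (\<forall>i j k l. c i j k l holomorphic_on D) \<and>
           F = (\<lambda>x. \<Sum>(i, j, k, l)\<in>monomials n a b.
                  c i j k l (x (Ce 0)) * x Cs ^ i * x Ct ^ j * x Cv ^ k * x Cw ^ l)}"

definition hirzebruch_point :: "point \<Rightarrow> bool" where
  "hirzebruch_point x \<longleftrightarrow> (x Cs, x Ct) \<noteq> (0, 0) \<and> (x Cv, x Cw) \<noteq> (0, 0)"

text \<open>
  The irreducible curves of class \<open>a h + b f\<close>, given by an equation.  Factors of a
  homogeneous polynomial are homogeneous, so it suffices to exclude homogeneous factors.
\<close>

definition irreducible_curve :: "nat \<Rightarrow> nat \<Rightarrow> nat \<Rightarrow> (point \<Rightarrow> complex) \<Rightarrow> bool" where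
  "irreducible_curve n a b C \<longleftrightarrow>
     C \<in> sections n a b \<and> C \<noteq> (\<lambda>x. 0) \<and> (a, b) \<noteq> (0, 0) \<and>
     (\<forall>a1 b1 a2 b2 G H. G \<in> sections n a1 b1 \<longrightarrow> H \<in> sections n a2 b2 \<longrightarrow>
        C = (\<lambda>x. G x * H x) \<longrightarrow> (a1, b1) = (0, 0) \<or> (a2, b2) = (0, 0))"

definition locus :: "(point \<Rightarrow> complex) \<Rightarrow> point set" where
  "locus C = {x. hirzebruch_point x \<and> C x = 0}"

section \<open>Vanishing orders\<close>

text \<open>
  \<open>F\<close> has multiplicity at least \<open>m\<close> at \<open>x\<close>: it vanishes to order \<open>m\<close> at \<open>x\<close> on all lines
  through \<open>x\<close>.  As multiplicity is upper semicontinuous, the vanishing order along an irreducible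
  subvariety (its value at the generic point) is at least \<open>m\<close> iff this holds at all of its points.
\<close>

definition multiplicity_ge :: "nat \<Rightarrow> (point \<Rightarrow> complex) \<Rightarrow> point \<Rightarrow> bool" where
  "multiplicity_ge m F x \<longleftrightarrow>
     (\<forall>y :: point. \<forall>j<m. (deriv ^^ j) (\<lambda>z :: complex. F (\<lambda>c. x c + z * y c)) 0 = 0)"

definition ord_ge :: "nat \<Rightarrow> (point \<Rightarrow> complex) \<Rightarrow> point set \<Rightarrow> bool" where
  "ord_ge m F X \<longleftrightarrow> (\<forall>x\<in>X. multiplicity_ge m F x)"

definition discr :: "(point \<Rightarrow> complex) \<Rightarrow> (point \<Rightarrow> complex) \<Rightarrow> point \<Rightarrow> complex" where
  "discr F G x = 4 * F x ^ 3 + 27 * G x ^ 2"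

definition nonminimal :: "(point \<Rightarrow> complex) \<Rightarrow> (point \<Rightarrow> complex) \<Rightarrow> point set \<Rightarrow> bool" where
  "nonminimal F G X \<longleftrightarrow> ord_ge 4 F X \<and> ord_ge 6 G X \<and> ord_ge 12 (discr F G) X"

section \<open>Horizontal models\<close>

text \<open>
  The fiber over \<open>u\<close> is a Calabi--Yau Weierstrass model over \<open>F_n\<close>: an elliptic fibration
  which is minimal in codimension one (the line bundle is fixed below to be the anticanonical one).
\<close>

definition calabi_yau_fiber ::
    "nat \<Rightarrow> (point \<Rightarrow> complex) \<Rightarrow> (point \<Rightarrow> complex) \<Rightarrow> complex \<Rightarrow> bool" where
  "calabi_yau_fiber n f g u \<longleftrightarrow>
     (let fu = (\<lambda>x. f (x(Ce 0 := u))); gu = (\<lambda>x. g (x(Ce 0 := u))) in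
       (\<exists>x. hirzebruch_point x \<and> discr fu gu x \<noteq> 0) \<and>
       \<not> (\<exists>a b C. irreducible_curve n a b C \<and> nonminimal fu gu (locus C)))"

definition central :: "point set \<Rightarrow> point set" where
  "central X = {x \<in> X. x (Ce 0) = 0}"

text \<open>The irreducible curves in the central base over which the family is non-minimal.  The
  orders are those on the family, i.e. along a curve in the threefold \<open>F_n \<times> D\<close>.\<close>

definition nonminimal_curves ::
    "nat \<Rightarrow> (point \<Rightarrow> complex) \<Rightarrow> (point \<Rightarrow> complex) \<Rightarrow> point set set" where
  "nonminimal_curves n f g =
     {Z. \<exists>a b C. irreducible_curve n a b C \<and> Z = locus C \<and> nonminimal f g (central Z)}"

text \<open>\<open>f\<close> and \<open>g\<close> are sections of the 4th and 6th power of the pullback of the anticanonical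
  bundle, of class \<open>2h + (2 + n)f\<close>.\<close>

definition horizontal_model ::
    "nat \<Rightarrow> complex set \<Rightarrow> (point \<Rightarrow> complex) \<Rightarrow> (point \<Rightarrow> complex) \<Rightarrow> bool" where
  "horizontal_model n D f g \<longleftrightarrow>
     (\<exists>z r. D = ball z r) \<and> 0 \<in> D \<and>
     f \<in> family_sections n D (4 * 2) (4 * (2 + n)) \<and>
     g \<in> family_sections n D (6 * 2) (6 * (2 + n)) \<and>
     (\<forall>u\<in>D - {0}. calabi_yau_fiber n f g u) \<and>
     (\<exists>T. irreducible_curve n 1 n T \<and>
        nonminimal_curves n f g \<in>
          {{locus (\<lambda>x. x Cs)}, {locus T}, {locus (\<lambda>x. x Cs), locus T}})"

definition class_1_to_4 :: "nat \<Rightarrow> (point \<Rightarrow> complex) \<Rightarrow> (point \<Rightarrow> complex) \<Rightarrow> bool" where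
  "class_1_to_4 n f g \<longleftrightarrow>
     (\<forall>Z\<in>nonminimal_curves n f g. \<not> ord_ge 5 f (central Z) \<or> \<not> ord_ge 7 g (central Z))"

section \<open>Open-chain resolutions\<close>

text \<open>
  Homogeneous coordinates of the points of the blown-up base.  In the cyclic order
  \<open>Ct, Ce lo, ..., Ce hi, Cs\<close> (the rays of the fan) only neighbours may vanish simultaneously,
  and \<open>Ct\<close>, \<open>Cs\<close> do not count as neighbours.
\<close>

definition chain_point :: "int \<Rightarrow> int \<Rightarrow> point \<Rightarrow> bool" where
  "chain_point lo hi x \<longleftrightarrow>
     (x Cs, x Ct) \<noteq> (0, 0) \<and> (x Cv, x Cw) \<noteq> (0, 0) \<and>
     (x Cs = 0 \<longrightarrow> (\<forall>p\<in>{lo..<hi}. x (Ce p) \<noteq> 0)) \<and>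
     (x Ct = 0 \<longrightarrow> (\<forall>p\<in>{lo<..hi}. x (Ce p) \<noteq> 0)) \<and>
     (\<forall>p\<in>{lo..hi}. \<forall>q\<in>{lo..hi}. p + 1 < q \<longrightarrow> x (Ce p) \<noteq> 0 \<or> x (Ce q) \<noteq> 0)"

definition component :: "int \<Rightarrow> int \<Rightarrow> int \<Rightarrow> point set" where
  "component lo hi p = {x. chain_point lo hi x \<and> x (Ce p) = 0}"

text \<open>
  The isomorphism of \<open>F_n\<close> with the component \<open>p\<close>.  Coordinates that vanish nowhere on the
  component are set to 1.  The \<open>(-n)\<close>-curve is the intersection with the next component
  and \<open>Ct = 0\<close> the intersection with the previous one, if these components exist.
\<close>

definition embed :: "int \<Rightarrow> int \<Rightarrow> int \<Rightarrow> point \<Rightarrow> point" where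
  "embed lo hi p x = (\<lambda>c. case c of
       Cs \<Rightarrow> if p = hi then x Cs else 1
     | Ct \<Rightarrow> if p = lo then x Ct else 1
     | Cv \<Rightarrow> x Cv
     | Cw \<Rightarrow> x Cw
     | Ce q \<Rightarrow> if q = p then 0
               else if q = p + 1 \<and> p < hi then x Cs
               else if q = p - 1 \<and> lo < p then x Ct
               else 1)"

text \<open>
  Blow-up of the curve of class \<open>S\<close> in the last component given by
  \<open>s + c t \<Prod> e_p^(hi - p) = 0\<close>.  It is unique (\<open>c = 0\<close>) unless \<open>n = 0\<close>.  The monomial in
  the \<open>e_p\<close> makes the equation homogeneous.  In terms of the coordinates of the blow-up, with new
  exceptional coordinate \<open>e = Ce (hi + 1)\<close> and the strict transform of the equation as new \<open>Cs\<close>,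
  the old equation is \<open>e * Cs\<close>, and the old \<open>Ce hi\<close> is \<open>e * Ce hi\<close>.
\<close>

definition center_S :: "int \<Rightarrow> int \<Rightarrow> complex \<Rightarrow> point set" where
  "center_S lo hi c =
     {x \<in> component lo hi hi.
        x Cs + c * x Ct * (\<Prod>p=lo..hi. x (Ce p) ^ nat (hi - p)) = 0}"

definition blow_down_S :: "int \<Rightarrow> int \<Rightarrow> complex \<Rightarrow> point \<Rightarrow> point" where
  "blow_down_S lo hi c x = x(
     Cs := x Cs * x (Ce (hi + 1)) - c * x Ct * (\<Prod>p=lo..hi. x (Ce p) ^ nat (hi - p)),
     Ce hi := x (Ce hi) * x (Ce (hi + 1)))"

text \<open>
  Likewise for a curve of class \<open>T\<close> in the first component, given by
  \<open>t + s q(v, w) \<Prod> e_p^(p - lo) = 0\<close> for a form \<open>q\<close> of degree \<open>n\<close>.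
\<close>

definition center_T :: "int \<Rightarrow> int \<Rightarrow> (point \<Rightarrow> complex) \<Rightarrow> point set" where
  "center_T lo hi q =
     {x \<in> component lo hi lo.
        x Ct + x Cs * q x * (\<Prod>p=lo..hi. x (Ce p) ^ nat (p - lo)) = 0}"

definition blow_down_T :: "int \<Rightarrow> int \<Rightarrow> (point \<Rightarrow> complex) \<Rightarrow> point \<Rightarrow> point" where
  "blow_down_T lo hi q x = x(
     Ct := x Ct * x (Ce (lo - 1)) - x Cs * q x * (\<Prod>p=lo..hi. x (Ce p) ^ nat (p - lo)),
     Ce lo := x (Ce lo) * x (Ce (lo - 1)))"

text \<open>The quotient of \<open>F\<close> by the \<open>m\<close>-th power of \<open>Ce p\<close>, extended over \<open>Ce p = 0\<close>.\<close>

definition divide_exc :: "int \<Rightarrow> nat \<Rightarrow> (point \<Rightarrow> complex) \<Rightarrow> point \<Rightarrow> complex" where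
  "divide_exc p m F x = remove_sings (\<lambda>z. F (x(Ce p := z)) / z ^ m) (x (Ce p))"

text \<open>
  The models obtained by base change and successive blow-ups along non-minimal curves that keep
  the central fiber a reduced chain of surfaces \<open>F_n\<close>.  Dividing \<open>F\<close>, \<open>G\<close> by the 4th and 6th
  power of the exceptional coordinate divides \<open>discr F G\<close> by its 12th power.
\<close>

inductive chain_model ::
    "nat \<Rightarrow> (point \<Rightarrow> complex) \<Rightarrow> (point \<Rightarrow> complex) \<Rightarrow>
     int \<Rightarrow> int \<Rightarrow> (point \<Rightarrow> complex) \<Rightarrow> (point \<Rightarrow> complex) \<Rightarrow> bool"
  for n f g where
  base_change:
    "k \<ge> 1 \<Longrightarrow> chain_model n f g 0 0
       (\<lambda>x. f (x(Ce 0 := x (Ce 0) ^ k))) (\<lambda>x. g (x(Ce 0 := x (Ce 0) ^ k)))"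
| blow_up_S:
    "chain_model n f g lo hi F G \<Longrightarrow> n = 0 \<or> c = 0 \<Longrightarrow> nonminimal F G (center_S lo hi c) \<Longrightarrow>
     chain_model n f g lo (hi + 1)
       (divide_exc (hi + 1) 4 (F \<circ> blow_down_S lo hi c))
       (divide_exc (hi + 1) 6 (G \<circ> blow_down_S lo hi c))"
| blow_up_T:
    "chain_model n f g lo hi F G \<Longrightarrow> q \<in> sections n 0 n \<Longrightarrow> nonminimal F G (center_T lo hi q) \<Longrightarrow>
     chain_model n f g (lo - 1) hi
       (divide_exc (lo - 1) 4 (F \<circ> blow_down_T lo hi q))
       (divide_exc (lo - 1) 6 (G \<circ> blow_down_T lo hi q))"

text \<open>Kodaira type \<open>I_m\<close> of the elliptic fiber over the generic point of the component \<open>p\<close>.\<close>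

definition kodaira_I ::
    "int \<Rightarrow> int \<Rightarrow> (point \<Rightarrow> complex) \<Rightarrow> (point \<Rightarrow> complex) \<Rightarrow> int \<Rightarrow> nat \<Rightarrow> bool" where
  "kodaira_I lo hi F G p m \<longleftrightarrow>
     ord_ge m (discr F G) (component lo hi p) \<and>
     \<not> ord_ge (Suc m) (discr F G) (component lo hi p) \<and>
     (m > 0 \<longrightarrow> (\<exists>x. hirzebruch_point x \<and> F (embed lo hi p x) \<noteq> 0) \<and>
                (\<exists>x. hirzebruch_point x \<and> G (embed lo hi p x) \<noteq> 0))"

definition infinite_distance_free ::
    "nat \<Rightarrow> int \<Rightarrow> int \<Rightarrow> (point \<Rightarrow> complex) \<Rightarrow> (point \<Rightarrow> complex) \<Rightarrow> bool" where
  "infinite_distance_free n lo hi F G \<longleftrightarrow>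
     \<not> (\<exists>p\<in>{lo..hi}. \<exists>a b C. irreducible_curve n a b C \<and>
          ord_ge 4 (F \<circ> embed lo hi p) (locus C) \<and>
          ord_ge 6 (G \<circ> embed lo hi p) (locus C))"

text \<open>\<open>N p\<close> is the \<open>m\<close> in the Kodaira type \<open>I_m\<close> over the component \<open>p\<close>.\<close>

definition open_chain_resolution ::
    "nat \<Rightarrow> (point \<Rightarrow> complex) \<Rightarrow> (point \<Rightarrow> complex) \<Rightarrow>
     int \<Rightarrow> int \<Rightarrow> (point \<Rightarrow> complex) \<Rightarrow> (point \<Rightarrow> complex) \<Rightarrow> (int \<Rightarrow> nat) \<Rightarrow> bool" where
  "open_chain_resolution n f g lo hi F G N \<longleftrightarrow>
     chain_model n f g lo hi F G \<and>
     (\<forall>p\<in>{lo..hi}. kodaira_I lo hi F G p (N p)) \<and>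
     infinite_distance_free n lo hi F G"

definition type_III_b :: "nat \<Rightarrow> (point \<Rightarrow> complex) \<Rightarrow> (point \<Rightarrow> complex) \<Rightarrow> bool" where
  "type_III_b n f g \<longleftrightarrow>
     (\<exists>lo hi F G N. open_chain_resolution n f g lo hi F G N \<and>
        hi - lo \<ge> 1 \<and> (\<forall>p\<in>{lo..hi}. N p > 0))"

end

theory Submission
  imports Defs
begin

text \<open>
  Let \<open>n \<ge> 5\<close>.  On the last component the \<open>(-n)\<close>-curve \<open>s = 0\<close> has such negative
  self-intersection that the grading forces \<open>f\<close> and \<open>g\<close> to vanish there to orders at least 2 and 4:
  \<open>f = b s\<^sup>2 + a s\<^sup>3 + ...\<close> and \<open>g = b' s\<^sup>4 + a' s\<^sup>5 + ...\<close>.  If the generic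
  fiber over the component is of type \<open>I_m\<close> with \<open>m > 0\<close>, then \<open>4 f\<^sup>3 + 27 g\<^sup>2\<close> vanishes identically on
  it, and comparing orders in \<open>s\<close> gives \<open>b = b' = a = a' = 0\<close>, one after the other.  Hence \<open>(f, g)\<close> vanish to
  orders \<open>(4, 6)\<close> along \<open>s = 0\<close>, which is excluded.  To see that the grading survives the blow-ups,
  pull the original polynomials back under the total blow-down: where the earlier exceptional
  coordinates do not vanish this gives a closed formula, in which only \<open>a\<close> and \<open>b\<close> carry negative
  powers of the last exceptional coordinate.  These are compensated by the non-minimality of the
  blown-up curves, which makes \<open>a\<close> and \<open>b\<close> divisible by powers of \<open>u\<close>.
\<close>

section \<open>Orders of vanishing in one variable\<close>

lemma isCont_zero_if_eventually_zero:
  fixes r :: "complex \<Rightarrow> complex"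
  assumes "isCont r a" "\<forall>\<^sub>F z in at a. r z = 0"
  shows "r a = 0"
proof -
  have "(r \<longlongrightarrow> 0) (at a)"
    using assms(2) by (simp add: tendsto_eventually)
  then show ?thesis
    using assms(1) LIM_unique isCont_def by blast
qed

lemma analytic_at_compose_ball:
  assumes "f holomorphic_on ball 0 \<delta>" "U analytic_on {a}" "norm (U a) < \<delta>"
  shows "(\<lambda>z. f (U z)) analytic_on {a}"
proof -
  have "f analytic_on U ` {a}"
    by (rule analytic_on_subset[of _ "ball 0 \<delta>"]) (use assms in \<open>auto simp: analytic_on_open\<close>)
  then show ?thesis
    using analytic_on_compose[OF assms(2)] by (simp add: o_def)
qed

text \<open>The quotient \<open>f z / z\<close> with its removable singularity filled in when
  \<open>f 0 = 0\<close>. Through it the coefficients shed factors \<open>u\<close> at each blow-up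
  of class \<open>S\<close>.\<close>

definition div_z :: "(complex \<Rightarrow> complex) \<Rightarrow> complex \<Rightarrow> complex" where
  "div_z f z = (if z = 0 then deriv f 0 else f z / z)"

lemma holomorphic_div_z:
  assumes "f holomorphic_on ball 0 \<delta>" "f 0 = 0"
  shows "div_z f holomorphic_on ball 0 \<delta>"
  using pole_lemma_open[OF assms(1) open_ball, of 0] assms(2) by (simp add: div_z_def[abs_def] cong: if_cong)

lemma mult_div_z: "f 0 = 0 \<Longrightarrow> z * div_z f z = f z"
  by (simp add: div_z_def)

lemma analytic_div_z:
  assumes "f analytic_on {0}" "f 0 = 0"
  shows "div_z f analytic_on {0}"
proof -
  obtain \<delta> where "\<delta> > 0" "f holomorphic_on ball 0 \<delta>"
    using assms(1) by (auto simp: analytic_on_def)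
  then show ?thesis
    using holomorphic_div_z[of f \<delta>] assms(2) by (auto simp: analytic_on_def)
qed

text \<open>One differentiation turns \<open>z ^ Suc m * \<omega>\<close> into \<open>z ^ m\<close>
  times \<open>\<omega>'\<close>. The value of the cofactor at 0 is tracked because for
  \<open>j = d\<close> it ties \<open>\<psi> 0\<close> to the \<open>d\<close>-th
  derivative.\<close>

lemma higher_deriv_power_mult:
  assumes "\<psi> analytic_on {0}" "\<forall>\<^sub>F z in nhds 0. \<phi> z = z ^ d * \<psi> z" "j \<le> d"
  shows "\<exists>\<omega>. \<omega> analytic_on {0} \<and> \<omega> 0 = fact d / fact (d - j) * \<psi> 0 \<and>
           (\<forall>\<^sub>F z in nhds 0. (deriv ^^ j) \<phi> z = z ^ (d - j) * \<omega> z)"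
  using assms(3)
proof (induction j)
  case 0
  then show ?case using assms(1,2) by auto
next
  case (Suc j)
  then obtain \<omega> where \<omega>: "\<omega> analytic_on {0}" "\<omega> 0 = fact d / fact (d - j) * \<psi> 0"
      and ev: "\<forall>\<^sub>F z in nhds 0. (deriv ^^ j) \<phi> z = z ^ (d - j) * \<omega> z"
    by auto
  define m where "m = d - Suc j"
  have m: "d - j = Suc m"
    using Suc.prems by (simp add: m_def)
  define \<omega>' where "\<omega>' = (\<lambda>z. of_nat (Suc m) * \<omega> z + z * deriv \<omega> z)"
  have "\<omega>' analytic_on {0}"
    unfolding \<omega>'_def by (intro analytic_intros \<omega>(1) analytic_deriv)
  moreover have "\<omega>' 0 = fact d / fact m * \<psi> 0"
    by (simp add: \<omega>'_def \<omega>(2) m field_simps del: of_nat_Suc)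
  moreover have "\<forall>\<^sub>F z in nhds 0. (deriv ^^ Suc j) \<phi> z = z ^ m * \<omega>' z"
  proof -
    obtain e where e: "e > 0" "\<omega> holomorphic_on ball 0 e"
      using \<omega>(1) by (auto simp: analytic_on_def)
    have "\<forall>\<^sub>F z in nhds 0. z \<in> ball (0::complex) e"
      using e by (intro eventually_nhds_in_open) auto
    moreover have "\<forall>\<^sub>F y in nhds 0. \<forall>\<^sub>F z in nhds y. (deriv ^^ j) \<phi> z = z ^ Suc m * \<omega> z"
      using ev by (simp add: m eventually_eventually)
    ultimately show ?thesis
    proof eventually_elim
      case (elim y)
      have der: "(\<omega> has_field_derivative deriv \<omega> y) (at y)"
        by (rule holomorphic_derivI[OF e(2) open_ball elim(1)])
      have "(deriv ^^ Suc j) \<phi> y = deriv (\<lambda>z. z ^ Suc m * \<omega> z) y"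
        using deriv_cong_ev[OF elim(2) refl] by simp
      also have "\<dots> = z_der" if "z_der = y ^ m * \<omega>' y" for z_der
        unfolding that \<omega>'_def
        by (rule DERIV_imp_deriv, (rule derivative_eq_intros der refl)+) (simp add: algebra_simps)
      finally show ?case by simp
    qed
  qed
  ultimately show ?case
    unfolding m_def[symmetric] by blast
qed

lemma higher_deriv_zero_if_power_mult:
  assumes "\<psi> analytic_on {0}" "\<forall>\<^sub>F z in nhds 0. \<phi> z = z ^ d * \<psi> z" "j < d"
  shows "(deriv ^^ j) \<phi> 0 = 0"
proof -
  obtain \<omega> where "\<forall>\<^sub>F z in nhds 0. (deriv ^^ j) \<phi> z = z ^ (d - j) * \<omega> z"
    using higher_deriv_power_mult[OF assms(1,2)] assms(3) by (meson less_imp_le)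
  then show ?thesis
    using assms(3) by (auto dest: eventually_nhds_x_imp_x)
qed

text \<open>One \<open>z\<close> is split off at a time: the \<open>d\<close>-th derivative at 0 is
  \<open>fact d * \<psi> 0\<close>, so its vanishing makes the cofactor divisible by
  \<open>z\<close>.\<close>

lemma power_mult_if_higher_deriv_zero:
  assumes "\<phi> analytic_on {0}" "\<forall>j<d. (deriv ^^ j) \<phi> 0 = 0"
  shows "\<exists>\<psi>. \<psi> analytic_on {0} \<and> (\<forall>\<^sub>F z in nhds 0. \<phi> z = z ^ d * \<psi> z)"
  using assms(2)
proof (induction d)
  case 0
  then show ?case using assms(1) by auto
next
  case (Suc d)
  then obtain \<psi> where \<psi>: "\<psi> analytic_on {0}" "\<forall>\<^sub>F z in nhds 0. \<phi> z = z ^ d * \<psi> z"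
    by auto
  obtain \<omega> where \<omega>: "\<omega> 0 = fact d / fact (d - d) * \<psi> 0"
      "\<forall>\<^sub>F z in nhds 0. (deriv ^^ d) \<phi> z = z ^ (d - d) * \<omega> z"
    using higher_deriv_power_mult[OF \<psi> order_refl] by blast
  have "(deriv ^^ d) \<phi> 0 = \<omega> 0"
    using eventually_nhds_x_imp_x[OF \<omega>(2)] by simp
  then have 0: "\<psi> 0 = 0"
    using Suc.prems \<omega>(1) by simp
  have "\<forall>\<^sub>F z in nhds 0. \<phi> z = z ^ Suc d * div_z \<psi> z"
    using \<psi>(2)
  proof eventually_elim
    case (elim z)
    then show ?case
      using mult_div_z[of \<psi> z, OF 0] by (simp add: mult.assoc mult.left_commute)
  qed
  then show ?case
    using analytic_div_z[OF \<psi>(1) 0] by blast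
qed


section \<open>The pullback under the total blow-down\<close>

text \<open>
  Analyticity along analytic arcs takes the place of holomorphy in several variables.
\<close>

definition jointly_holomorphic ::
    "real \<Rightarrow> (complex \<Rightarrow> complex \<Rightarrow> complex \<Rightarrow> complex \<Rightarrow> complex \<Rightarrow> complex) \<Rightarrow> bool" where
  "jointly_holomorphic \<delta> H \<longleftrightarrow>
     (\<forall>a S T V W U. S analytic_on {a} \<longrightarrow> T analytic_on {a} \<longrightarrow> V analytic_on {a} \<longrightarrow>
        W analytic_on {a} \<longrightarrow> U analytic_on {a} \<longrightarrow> norm (U a) < \<delta> \<longrightarrow>
        (\<lambda>z. H (S z) (T z) (V z) (W z) (U z)) analytic_on {a})"

lemma jointly_holomorphicD:
  assumes "jointly_holomorphic \<delta> H" "S analytic_on {a}" "T analytic_on {a}" "V analytic_on {a}"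
    "W analytic_on {a}" "U analytic_on {a}" "norm (U a) < \<delta>"
  shows "(\<lambda>z. H (S z) (T z) (V z) (W z) (U z)) analytic_on {a}"
  using assms unfolding jointly_holomorphic_def by blast

section \<open>Monomials in the exceptional coordinates\<close>

definition ce_prod :: "int \<Rightarrow> int \<Rightarrow> (int \<Rightarrow> nat) \<Rightarrow> point \<Rightarrow> complex" where
  "ce_prod lo hi h x = (\<Prod>p=lo..hi. x (Ce p) ^ h p)"

lemma ce_prod_mult: "ce_prod lo hi h x * ce_prod lo hi h' x = ce_prod lo hi (\<lambda>p. h p + h' p) x"
  by (simp add: ce_prod_def power_add prod.distrib)

lemma ce_prod_power: "ce_prod lo hi h x ^ m = ce_prod lo hi (\<lambda>p. h p * m) x"
  by (simp add: ce_prod_def power_mult prod_power_distrib)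

lemma ce_prod_cong:
  "(\<And>p. lo \<le> p \<Longrightarrow> p \<le> hi \<Longrightarrow> x (Ce p) ^ h p = x' (Ce p) ^ h' p) \<Longrightarrow>
   ce_prod lo hi h x = ce_prod lo hi h' x'"
  unfolding ce_prod_def by (rule prod.cong) auto

lemma ce_prod_eq_0_iff: "ce_prod lo hi h x = 0 \<longleftrightarrow> (\<exists>p\<in>{lo..hi}. x (Ce p) = 0 \<and> h p > 0)"
  by (auto simp: ce_prod_def)

lemma ce_prod_split:
  assumes "p \<in> {lo..hi}"
  shows "ce_prod lo hi h x = x (Ce p) ^ h p * (\<Prod>q\<in>{lo..hi} - {p}. x (Ce q) ^ h q)"
  unfolding ce_prod_def using assms by (simp add: prod.remove)

lemma ce_prod_single:
  assumes "p \<in> {lo..hi}" "\<And>q. q \<in> {lo..hi} \<Longrightarrow> q \<noteq> p \<Longrightarrow> x (Ce q) = 1"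
  shows "ce_prod lo hi h x = x (Ce p) ^ h p"
  unfolding ce_prod_split[OF assms(1)] using assms(2) by simp

lemma ce_prod_extend_hi:
  assumes "lo \<le> hi"
  shows "ce_prod lo (hi + 1) h x = ce_prod lo hi h x * x (Ce (hi + 1)) ^ h (hi + 1)"
proof -
  have "{lo..hi + 1} = insert (hi + 1) {lo..hi}"
    using assms by auto
  then show ?thesis
    by (simp add: ce_prod_def mult.commute)
qed

lemma ce_prod_extend_lo:
  assumes "lo \<le> hi"
  shows "ce_prod (lo - 1) hi h x = ce_prod lo hi h x * x (Ce (lo - 1)) ^ h (lo - 1)"
proof -
  have "{lo - 1..hi} = insert (lo - 1) {lo..hi}"
    using assms by auto
  then show ?thesis
    by (simp add: ce_prod_def mult.commute)
qed

lemma ce_prod_scale: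
  assumes "p \<in> {lo..hi}" "y (Ce p) = x (Ce p) * c" "\<And>q. q \<in> {lo..hi} \<Longrightarrow> q \<noteq> p \<Longrightarrow> y (Ce q) = x (Ce q)"
  shows "ce_prod lo hi h y = ce_prod lo hi h x * c ^ h p"
  unfolding ce_prod_split[OF assms(1)] using assms(2,3) by (simp add: power_mult_distrib)

lemma analytic_ce_prod [analytic_intros]:
  assumes "\<And>c. (\<lambda>z. X z c) analytic_on A"
  shows "(\<lambda>z. ce_prod lo hi h (X z)) analytic_on A"
  unfolding ce_prod_def by (intro analytic_intros assms)

text \<open>
  The total blow-down sends \<open>(s, t)\<close> to \<open>(s * s_factor, t_total)\<close>.  The term \<open>Q\<close> of \<open>t_total\<close> collects
  the equations of the blown-up curves of class \<open>h + n f\<close>.  The \<open>d\<close>-th powers that are divided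
  out multiply up to \<open>(s_factor * t_factor) ^ d\<close>, and \<open>u_excess\<close> is \<open>u ^ hi / s_factor\<close>.
\<close>

abbreviation u_coord :: "int \<Rightarrow> int \<Rightarrow> point \<Rightarrow> complex" where
  "u_coord lo hi \<equiv> ce_prod lo hi (\<lambda>_. 1)"

abbreviation s_factor :: "int \<Rightarrow> int \<Rightarrow> point \<Rightarrow> complex" where
  "s_factor lo hi \<equiv> ce_prod lo hi nat"

abbreviation t_factor :: "int \<Rightarrow> int \<Rightarrow> point \<Rightarrow> complex" where
  "t_factor lo hi \<equiv> ce_prod lo hi (\<lambda>p. nat (- p))"

abbreviation u_excess :: "int \<Rightarrow> int \<Rightarrow> point \<Rightarrow> complex" where
  "u_excess lo hi \<equiv> ce_prod lo hi (\<lambda>p. nat (hi - max p 0))"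

definition t_total ::
    "int \<Rightarrow> int \<Rightarrow> (complex \<Rightarrow> complex \<Rightarrow> complex \<Rightarrow> complex) \<Rightarrow> point \<Rightarrow> complex" where
  "t_total lo hi Q x =
     x Ct * t_factor lo hi x - x Cs * s_factor lo hi x * Q (x Cv) (x Cw) (u_coord lo hi x)"

text \<open>
  \<open>u ^ hi * A\<close> and \<open>u ^ (2 * hi) * B\<close> are the coefficients of \<open>s ^ (d - 1)\<close> and \<open>s ^ (d - 2)\<close> in the
  original polynomial.
\<close>

definition chart ::
    "nat \<Rightarrow> int \<Rightarrow> int \<Rightarrow> (complex \<Rightarrow> complex \<Rightarrow> complex \<Rightarrow> complex) \<Rightarrow>
     (complex \<Rightarrow> complex \<Rightarrow> complex \<Rightarrow> complex) \<Rightarrow>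
     (complex \<Rightarrow> complex \<Rightarrow> complex \<Rightarrow> complex \<Rightarrow> complex \<Rightarrow> complex) \<Rightarrow>
     (complex \<Rightarrow> complex \<Rightarrow> complex \<Rightarrow> complex) \<Rightarrow> point \<Rightarrow> complex" where
  "chart d lo hi A B H Q x =
     (A (x Cv) (x Cw) (u_coord lo hi x) * u_excess lo hi x * x Cs ^ (d - 1) *
        t_total lo hi Q x ^ (d + 1) +
      B (x Cv) (x Cw) (u_coord lo hi x) * u_excess lo hi x ^ 2 * x Cs ^ (d - 2) *
        t_total lo hi Q x ^ (d + 2) +
      x Cs ^ d * H (x Cs * s_factor lo hi x) (t_total lo hi Q x) (x Cv) (x Cw) (u_coord lo hi x))
     / t_factor lo hi x ^ d"

text \<open>The invariant carried along the chain. Equality with the chart is asked only where the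
  \<open>Ce p\<close> with \<open>p < hi\<close> are nonzero, so that \<open>t_factor\<close> can be
  inverted; \<open>Ce hi\<close> may vanish, which includes generic points of the last component.
  The bound \<open>\<delta>\<close> keeps \<open>u\<close> where the coefficients are
  holomorphic.\<close>

definition charted ::
    "nat \<Rightarrow> int \<Rightarrow> int \<Rightarrow> real \<Rightarrow> (complex \<Rightarrow> complex \<Rightarrow> complex \<Rightarrow> complex) \<Rightarrow>
     (complex \<Rightarrow> complex \<Rightarrow> complex \<Rightarrow> complex) \<Rightarrow>
     (complex \<Rightarrow> complex \<Rightarrow> complex \<Rightarrow> complex \<Rightarrow> complex \<Rightarrow> complex) \<Rightarrow>
     (complex \<Rightarrow> complex \<Rightarrow> complex \<Rightarrow> complex) \<Rightarrow> (point \<Rightarrow> complex) \<Rightarrow> bool" where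
  "charted d lo hi \<delta> A B H Q F \<longleftrightarrow>
     \<delta> > 0 \<and> d \<ge> 2 \<and> lo \<le> 0 \<and> 0 \<le> hi \<and>
     jointly_holomorphic \<delta> H \<and> jointly_holomorphic \<delta> (\<lambda>s t. Q) \<and>
     (\<forall>v w. (v, w) \<noteq> (0, 0) \<longrightarrow>
        A v w holomorphic_on ball 0 \<delta> \<and> B v w holomorphic_on ball 0 \<delta>) \<and>
     (\<forall>x. (x Cv, x Cw) \<noteq> (0, 0) \<longrightarrow> (\<forall>p\<in>{lo..<hi}. x (Ce p) \<noteq> 0) \<longrightarrow>
        norm (u_coord lo hi x) < \<delta> \<longrightarrow> F x = chart d lo hi A B H Q x)"

lemma t_factor_nonzero:
  assumes "0 \<le> hi" "\<forall>p\<in>{lo..<hi}. x (Ce p) \<noteq> 0"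
  shows "t_factor lo hi x \<noteq> 0"
  using assms by (force simp: ce_prod_eq_0_iff)

lemma analytic_t_total:
  assumes "charted d lo hi \<delta> A B H Q F" "\<And>c. (\<lambda>z. X z c) analytic_on {a}"
    "norm (u_coord lo hi (X a)) < \<delta>"
  shows "(\<lambda>z. t_total lo hi Q (X z)) analytic_on {a}"
proof -
  have Q: "jointly_holomorphic \<delta> (\<lambda>s t. Q)"
    using assms(1) by (simp add: charted_def)
  show ?thesis
    unfolding t_total_def using assms(3)
    by (intro analytic_intros assms(2) jointly_holomorphicD[OF Q, of "\<lambda>_. 0" _ "\<lambda>_. 0"]) auto
qed

text \<open>The arcs keep \<open>(v, w)\<close> fixed because \<open>A\<close> and \<open>B\<close>
  are known to be holomorphic in \<open>u\<close> only.\<close>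

lemma analytic_chart:
  assumes ch: "charted d lo hi \<delta> A B H Q F" and X: "\<And>c. (\<lambda>z. X z c) analytic_on {a}"
    and u: "norm (u_coord lo hi (X a)) < \<delta>"
    and vw: "\<And>z. X z Cv = v" "\<And>z. X z Cw = w" "(v, w) \<noteq> (0, 0)"
    and nz: "\<forall>p\<in>{lo..<hi}. X a (Ce p) \<noteq> 0"
  shows "(\<lambda>z. chart d lo hi A B H Q (X z)) analytic_on {a}"
proof -
  have H: "jointly_holomorphic \<delta> H" and A: "A v w holomorphic_on ball 0 \<delta>"
    and B: "B v w holomorphic_on ball 0 \<delta>" and hi: "0 \<le> hi"
    using ch vw(3) by (auto simp: charted_def)
  have U: "(\<lambda>z. u_coord lo hi (X z)) analytic_on {a}"
    by (intro analytic_intros X)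
  have V: "(\<lambda>z. v) analytic_on {a}" for v :: complex
    by (intro analytic_intros)
  show ?thesis
    unfolding chart_def vw(1,2)
    by (intro analytic_intros analytic_t_total[OF ch] X u U V jointly_holomorphicD[OF H]
        analytic_at_compose_ball[OF A] analytic_at_compose_ball[OF B])
       (use t_factor_nonzero[OF hi nz] in auto)
qed

lemma charted_eq:
  assumes "charted d lo hi \<delta> A B H Q F" "(x Cv, x Cw) \<noteq> (0, 0)" "\<forall>p\<in>{lo..<hi}. x (Ce p) \<noteq> 0"
    "norm (u_coord lo hi x) < \<delta>"
  shows "F x = chart d lo hi A B H Q x"
  using assms unfolding charted_def by blast

text \<open>The formula for \<open>z \<noteq> 0\<close> determines the extension across 0: the chart
  is analytic in \<open>Ce p\<close>, hence is the limit that \<open>remove_sings\<close>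
  takes.\<close>

lemma divide_exc_eq_chart:
  assumes ch: "charted d lo hi \<delta> A B H Q (chart d lo hi A B H Q)"
    and x: "(x Cv, x Cw) \<noteq> (0, 0)" "\<forall>p\<in>{lo..<hi}. x (Ce p) \<noteq> 0" "norm (u_coord lo hi x) < \<delta>"
    and G: "\<And>z. z \<noteq> 0 \<Longrightarrow> norm (u_coord lo hi (x(Ce p := z))) < \<delta> \<Longrightarrow>
      G (x(Ce p := z)) / z ^ d = chart d lo hi A B H Q (x(Ce p := z))"
  shows "divide_exc p d G x = chart d lo hi A B H Q x"
proof -
  define X where "X = (\<lambda>z. x(Ce p := z))"
  define a where "a = x (Ce p)"
  have Xa: "X a = x"
    by (simp add: X_def a_def)
  have X: "(\<lambda>z. X z c) analytic_on {a}" for c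
    unfolding X_def by (cases "c = Ce p") (auto intro!: analytic_intros)
  have "(\<lambda>z. chart d lo hi A B H Q (X z)) analytic_on {a}"
    by (rule analytic_chart[OF ch X]) (use x in \<open>auto simp: X_def a_def\<close>)
  then have lim: "((\<lambda>z. chart d lo hi A B H Q (X z)) \<longlongrightarrow> chart d lo hi A B H Q x) (at a)"
    using analytic_at_imp_isCont Xa unfolding isCont_def by fastforce
  have "(\<lambda>z. u_coord lo hi (X z)) analytic_on {a}"
    by (intro analytic_intros X)
  then have "((\<lambda>z. u_coord lo hi (X z)) \<longlongrightarrow> u_coord lo hi x) (at a)"
    using analytic_at_imp_isCont Xa unfolding isCont_def by fastforce
  then have "((\<lambda>z. norm (u_coord lo hi (X z))) \<longlongrightarrow> norm (u_coord lo hi x)) (at a)"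
    by (rule tendsto_norm)
  then have "\<forall>\<^sub>F z in at a. norm (u_coord lo hi (X z)) < \<delta>"
    using x(3) by (rule order_tendstoD)
  then have "\<forall>\<^sub>F z in at a. chart d lo hi A B H Q (X z) = G (X z) / z ^ d"
    using eventually_neq_at_within[of 0]
  proof eventually_elim
    case (elim z)
    then show ?case
      using G[of z] unfolding X_def by metis
  qed
  then have "((\<lambda>z. G (X z) / z ^ d) \<longlongrightarrow> chart d lo hi A B H Q x) (at a)"
    by (rule Lim_transform_eventually[OF lim])
  then show ?thesis
    unfolding divide_exc_def X_def a_def by (rule remove_sings_eqI)
qed

section \<open>The two kinds of blow-up\<close>

text \<open>In the chart this blow-up only affects \<open>t\<close>: the equation of the curve is
  absorbed into \<open>Q\<close>, and division by the \<open>d\<close>-th power of the new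
  coordinate enlarges \<open>t_factor\<close> by that coordinate.\<close>

lemma charted_blow_up_T:
  assumes ch: "charted d lo hi \<delta> A B H Q F" and q: "q \<in> sections n 0 n"
  shows "\<exists>Q'. charted d (lo - 1) hi \<delta> A B H Q' (divide_exc (lo - 1) d (F \<circ> blow_down_T lo hi q))"
proof -
  obtain c where c: "q = (\<lambda>x. \<Sum>(i, j, k, l)\<in>monomials n 0 n.
      c i j k l * x Cs ^ i * x Ct ^ j * x Cv ^ k * x Cw ^ l)"
    using q by (auto simp: sections_def)
  define q0 where "q0 = (\<lambda>v w :: complex. \<Sum>(i, j, k, l)\<in>monomials n 0 n. c i j k l * v ^ k * w ^ l)"
  have q_eq: "q x = q0 (x Cv) (x Cw)" for x
    unfolding c q0_def by (rule sum.cong) (auto simp: monomials_def)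
  define Q' where "Q' = (\<lambda>v w u. Q v w u + q0 v w * u ^ nat (- lo))"
  have lohi: "lo \<le> 0" "0 \<le> hi" "lo \<le> hi" and Q: "jointly_holomorphic \<delta> (\<lambda>s t. Q)"
    using ch by (auto simp: charted_def)
  have Q': "jointly_holomorphic \<delta> (\<lambda>s t. Q')"
    unfolding jointly_holomorphic_def
  proof (intro allI impI)
    fix a :: complex and S T V W U :: "complex \<Rightarrow> complex"
    assume *: "S analytic_on {a}" "T analytic_on {a}" "V analytic_on {a}" "W analytic_on {a}"
      "U analytic_on {a}" "norm (U a) < \<delta>"
    show "(\<lambda>z. Q' (V z) (W z) (U z)) analytic_on {a}"
      unfolding Q'_def q0_def case_prod_beta
      by (intro analytic_intros jointly_holomorphicD[OF Q *] *)
  qed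
  let ?e = "Ce (lo - 1)"
  have step: "F (blow_down_T lo hi q x) / x ?e ^ d = chart d (lo - 1) hi A B H Q' x"
    if x: "(x Cv, x Cw) \<noteq> (0, 0)" "\<forall>p\<in>{lo - 1..<hi}. x (Ce p) \<noteq> 0" "x ?e \<noteq> 0"
      "norm (u_coord (lo - 1) hi x) < \<delta>" for x
  proof -
    let ?y = "blow_down_T lo hi q x"
    have scale: "ce_prod lo hi h ?y = ce_prod lo hi h x * x ?e ^ h lo" for h
      by (rule ce_prod_scale) (use lohi in \<open>auto simp: blow_down_T_def\<close>)
    have yc: "?y Cv = x Cv" "?y Cw = x Cw" "?y Cs = x Cs"
      by (auto simp: blow_down_T_def)
    have u: "u_coord lo hi ?y = u_coord (lo - 1) hi x"
      by (simp add: scale ce_prod_extend_lo[OF lohi(3)])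
    have excess: "u_excess lo hi ?y = u_excess (lo - 1) hi x"
      using lohi by (simp add: scale ce_prod_extend_lo[OF lohi(3)])
    have sf: "s_factor lo hi ?y = s_factor (lo - 1) hi x"
      using lohi by (simp add: scale ce_prod_extend_lo[OF lohi(3)])
    have nat_lo: "nat (- (lo - 1)) = Suc (nat (- lo))"
      using lohi by simp
    have tf: "t_factor lo hi ?y * x ?e = t_factor (lo - 1) hi x"
      by (simp only: scale ce_prod_extend_lo[OF lohi(3)] nat_lo power_Suc) simp
    \<comment> \<open>Source of the power of \<open>u\<close> in \<open>Q'\<close>. Exponentwise
      this is \<open>(p - lo) + max (- p) 0 = max p 0 + (- lo)\<close>, and the new coordinate has
      exponent \<open>- lo\<close> on both sides.\<close>
    have shift: "(\<Prod>p=lo..hi. x (Ce p) ^ nat (p - lo)) * t_factor lo hi ?y =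
        s_factor (lo - 1) hi x * u_coord (lo - 1) hi x ^ nat (- lo)"
    proof -
      have "(\<Prod>p=lo..hi. x (Ce p) ^ nat (p - lo)) * t_factor lo hi x =
          s_factor lo hi x * ce_prod lo hi (\<lambda>_. 1) x ^ nat (- lo)"
        unfolding ce_prod_def[of lo hi "\<lambda>p. nat (p - lo)", symmetric] ce_prod_mult ce_prod_power
        by (intro ce_prod_cong arg_cong2[of _ _ _ _ power] refl) (use lohi in auto)
      then show ?thesis
        using lohi by (simp add: scale ce_prod_extend_lo[OF lohi(3)] power_mult_distrib
            flip: mult.assoc)
    qed
    have tt: "t_total lo hi Q ?y = t_total (lo - 1) hi Q' x"
    proof -
      have ring: "(a * e - s * r * E) * t = a * (t * e) - s * r * (E * t)" for a e s r E t :: complex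
        by (simp add: algebra_simps)
      have yt: "?y Ct = x Ct * x ?e - x Cs * q0 (x Cv) (x Cw) * (\<Prod>p=lo..hi. x (Ce p) ^ nat (p - lo))"
        by (simp add: blow_down_T_def q_eq)
      have "?y Ct * t_factor lo hi ?y = x Ct * (t_factor lo hi ?y * x ?e) -
          x Cs * q0 (x Cv) (x Cw) * ((\<Prod>p=lo..hi. x (Ce p) ^ nat (p - lo)) * t_factor lo hi ?y)"
        unfolding yt by (rule ring)
      then show ?thesis
        unfolding t_total_def Q'_def shift tf sf u yc by (simp add: algebra_simps)
    qed
    have F_eq: "F ?y = chart d lo hi A B H Q ?y"
    proof -
      have "?y (Ce p) \<noteq> 0" if "p \<in> {lo..<hi}" for p
        using x(2,3) that by (auto simp: blow_down_T_def)
      then show ?thesis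
        using x(1,4) by (intro charted_eq[OF ch]) (simp_all only: yc u, blast+)
    qed
    show ?thesis
      unfolding F_eq chart_def yc u excess sf tt tf[symmetric] power_mult_distrib
      by (rule divide_divide_eq_left)
  qed
  let ?F' = "divide_exc (lo - 1) d (F \<circ> blow_down_T lo hi q)"
  have ch0: "charted d (lo - 1) hi \<delta> A B H Q' (chart d (lo - 1) hi A B H Q')"
    using ch Q' by (simp add: charted_def)
  have "?F' x = chart d (lo - 1) hi A B H Q' x"
    if x: "(x Cv, x Cw) \<noteq> (0, 0)" "\<forall>p\<in>{lo - 1..<hi}. x (Ce p) \<noteq> 0"
      "norm (u_coord (lo - 1) hi x) < \<delta>" for x
  proof (rule divide_exc_eq_chart[OF ch0 x])
    fix z :: complex
    assume z: "z \<noteq> 0" "norm (u_coord (lo - 1) hi (x(?e := z))) < \<delta>"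
    have "F (blow_down_T lo hi q (x(?e := z))) / (x(?e := z)) ?e ^ d = chart d (lo - 1) hi A B H Q' (x(?e := z))"
      by (rule step[OF _ _ _ z(2)]) (use x(1,2) z(1) in auto)
    then have eq: "F (blow_down_T lo hi q (x(?e := z))) / z ^ d = chart d (lo - 1) hi A B H Q' (x(?e := z))"
      by (simp only: fun_upd_same)
    show "(F \<circ> blow_down_T lo hi q) (x(?e := z)) / z ^ d = chart d (lo - 1) hi A B H Q' (x(?e := z))"
      unfolding o_apply by (rule eq)
  qed
  then have "charted d (lo - 1) hi \<delta> A B H Q' ?F'"
    using ch0 by (simp add: charted_def)
  then show ?thesis by blast
qed


text \<open>
  Multiplicity \<open>d\<close> is tested on the lines \<open>(s, e_hi) = (z, \<eta> * z)\<close> through the center: \<open>\<eta> = 0\<close> gives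
  the two values, and then \<open>\<eta> = 1\<close> the derivative of \<open>B\<close>.
\<close>

lemma coeffs_vanish_if_ord_ge:
  assumes ch: "charted d lo hi \<delta> A B H Q F" and ord: "ord_ge d F (center_S lo hi 0)"
    and vw: "(v, w) \<noteq> (0, 0)"
  shows "A v w 0 = 0 \<and> B v w 0 = 0 \<and> div_z (B v w) 0 = 0"
proof -
  define m where "m = d - 2"
  have d: "d = Suc (Suc m)" and lohi: "lo \<le> 0" "0 \<le> hi" "lo \<le> hi" and \<delta>: "\<delta> > 0"
    and H: "jointly_holomorphic \<delta> H" and Q: "jointly_holomorphic \<delta> (\<lambda>s t. Q)"
    and A: "A v w holomorphic_on ball 0 \<delta>" and B: "B v w holomorphic_on ball 0 \<delta>"
    using ch vw by (auto simp: charted_def m_def)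
  \<comment> \<open>A point of the center over \<open>(v, w)\<close>, with \<open>t\<close> and all
    earlier exceptional coordinates set to 1.\<close>
  define x0 :: point where "x0 = (\<lambda>c. case c of Cs \<Rightarrow> 0 | Ct \<Rightarrow> 1 | Cv \<Rightarrow> v | Cw \<Rightarrow> w
    | Ce q \<Rightarrow> if q = hi then 0 else 1)"
  have x0: "x0 \<in> center_S lo hi 0"
    using vw lohi by (auto simp: center_S_def component_def chain_point_def x0_def)
  define T where "T = (\<lambda>\<eta> z. 1 - z * (\<eta> * z) ^ nat hi * Q v w (\<eta> * z))"
  \<comment> \<open>On the line, \<open>u = \<eta> * z\<close> and \<open>u_excess\<close> is 1. For
    \<open>z \<noteq> 0\<close> the factor \<open>z ^ (d - 2)\<close> cancels; \<open>R\<close> is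
    the \<open>H\<close> term minus the quotient of \<open>F\<close> by \<open>z ^ d\<close>, which
    multiplicity \<open>d\<close> makes analytic.\<close>
  have expansion: "\<exists>R. isCont R 0 \<and> (\<forall>\<^sub>F z in at 0.
      B v w (\<eta> * z) * T \<eta> z ^ (d + 2) + A v w (\<eta> * z) * z * T \<eta> z ^ (d + 1) + z\<^sup>2 * R z = 0)" for \<eta>
  proof -
    define X :: "complex \<Rightarrow> point" where "X = (\<lambda>z c. x0 c + z * (case c of Cs \<Rightarrow> 1 | Ce q \<Rightarrow> if q = hi then \<eta> else 0 | _ \<Rightarrow> 0))"
    have X: "(\<lambda>z. X z c) analytic_on {a}" for c a
      unfolding X_def by (intro analytic_intros)
    have Xc: "X z Cs = z" "X z Ct = 1" "X z Cv = v" "X z Cw = w" "X z (Ce q) = (if q = hi then \<eta> * z else 1)"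
      for z q
      by (simp_all add: X_def x0_def)
    have cep: "ce_prod lo hi h (X z) = (\<eta> * z) ^ h hi" for h z
      using ce_prod_single[of hi lo hi "X z" h] lohi by (simp add: Xc)
    have Teq: "t_total lo hi Q (X z) = T \<eta> z" for z
      using lohi by (simp add: t_total_def T_def cep Xc)
    define R0 where "R0 = (\<lambda>z. H (z * (\<eta> * z) ^ nat hi) (T \<eta> z) v w (\<eta> * z))"
    have small: "\<forall>\<^sub>F z in nhds 0. norm (\<eta> * z) < \<delta>"
    proof -
      have "((\<lambda>z. norm (\<eta> * z)) \<longlongrightarrow> norm (\<eta> * 0)) (nhds 0)"
        by (intro tendsto_norm tendsto_mult_left filterlim_ident)
      then show ?thesis
        using \<delta> by (intro order_tendstoD(2)) auto
    qed
    have F: "\<forall>\<^sub>F z in nhds 0. F (X z) = chart d lo hi A B H Q (X z)"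
      using small
    proof eventually_elim
      case (elim z)
      then show ?case
        using ch vw by (auto simp: charted_def Xc cep)
    qed
    have "(\<lambda>z. chart d lo hi A B H Q (X z)) analytic_on {0}"
      by (rule analytic_chart[OF ch X]) (use \<delta> vw in \<open>auto simp: Xc cep\<close>)
    then have "(\<lambda>z. F (X z)) analytic_on {0}"
      using analytic_at_cong[OF F refl] by simp
    moreover have "\<forall>j<d. (deriv ^^ j) (\<lambda>z. F (X z)) 0 = 0"
      using ord x0 unfolding ord_ge_def multiplicity_ge_def X_def by blast
    ultimately obtain \<psi> where \<psi>: "\<psi> analytic_on {0}" "\<forall>\<^sub>F z in nhds 0. F (X z) = z ^ d * \<psi> z"
      using power_mult_if_higher_deriv_zero by blast
    have "(\<lambda>z. H (X z Cs * s_factor lo hi (X z)) (t_total lo hi Q (X z)) (X z Cv) (X z Cw)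
        (u_coord lo hi (X z))) analytic_on {0}"
      by (intro jointly_holomorphicD[OF H] analytic_intros X analytic_t_total[OF ch X])
         (use \<delta> in \<open>auto simp: cep\<close>)
    then have R0: "R0 analytic_on {0}"
      by (simp add: R0_def Teq Xc cep)
    have "isCont (\<lambda>z. R0 z - \<psi> z) 0"
      using analytic_at_imp_isCont[OF R0] analytic_at_imp_isCont[OF \<psi>(1)] by simp
    moreover have "\<forall>\<^sub>F z in nhds 0. z \<noteq> 0 \<longrightarrow>
        B v w (\<eta> * z) * T \<eta> z ^ (d + 2) + A v w (\<eta> * z) * z * T \<eta> z ^ (d + 1)
          + z\<^sup>2 * (R0 z - \<psi> z) = 0"
      using F \<psi>(2)
    proof eventually_elim
      case (elim z)
      have "z ^ m * (B v w (\<eta> * z) * T \<eta> z ^ (d + 2) + A v w (\<eta> * z) * z * T \<eta> z ^ (d + 1)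
          + z\<^sup>2 * (R0 z - \<psi> z)) = chart d lo hi A B H Q (X z) - z ^ d * \<psi> z"
        using lohi by (simp add: chart_def Teq cep Xc d R0_def algebra_simps power2_eq_square)
      then show ?case
        using elim by auto
    qed
    ultimately show ?thesis
      by (auto simp: eventually_at_filter)
  qed
  have T: "isCont (T \<eta>) 0" for \<eta>
  proof -
    have "(\<lambda>z. Q v w (\<eta> * z)) analytic_on {0}"
      by (rule jointly_holomorphicD[OF Q, of "\<lambda>_. 0" _ "\<lambda>_. 0"]) (use \<delta> in \<open>auto intro!: analytic_intros\<close>)
    from analytic_at_imp_isCont[OF this] show ?thesis
      unfolding T_def by (intro continuous_intros)
  qed
  have T0: "T \<eta> 0 = 1" for \<eta>
    by (simp add: T_def)
  obtain R where R: "isCont R 0" "\<forall>\<^sub>F z in at 0.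
      B v w 0 * T 0 z ^ (d + 2) + A v w 0 * z * T 0 z ^ (d + 1) + z\<^sup>2 * R z = 0"
    using expansion[of 0] by auto
  have B0: "B v w 0 = 0"
    using isCont_zero_if_eventually_zero[OF _ R(2)] by (simp add: continuous_intros R(1) T T0)
  have "\<forall>\<^sub>F z in at 0. A v w 0 * T 0 z ^ (d + 1) + z * R z = 0"
    using R(2) eventually_neq_at_within[of 0]
  proof eventually_elim
    case (elim z)
    then have "z * (A v w 0 * T 0 z ^ (d + 1) + z * R z) = 0"
      by (simp add: B0 algebra_simps power2_eq_square)
    then show ?case using elim by simp
  qed
  from isCont_zero_if_eventually_zero[OF _ this] have A0: "A v w 0 = 0"
    by (simp add: continuous_intros R(1) T T0)
  obtain R where R: "isCont R 0" "\<forall>\<^sub>F z in at 0.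
      B v w z * T 1 z ^ (d + 2) + A v w z * z * T 1 z ^ (d + 1) + z\<^sup>2 * R z = 0"
    using expansion[of 1] by auto
  have A1: "isCont (div_z (A v w)) 0" and B1: "isCont (div_z (B v w)) 0"
    using holomorphic_div_z[OF A A0] holomorphic_div_z[OF B B0] \<delta>
    by (auto dest!: holomorphic_on_imp_continuous_on simp: continuous_on_eq_continuous_at)
  \<comment> \<open>As \<open>A v w 0 = 0\<close>, the term with \<open>A\<close> is of second order
    in \<open>z\<close>, so after division by \<open>z\<close> only that of \<open>B\<close>
    survives at 0.\<close>
  have "\<forall>\<^sub>F z in at 0. div_z (B v w) z * T 1 z ^ (d + 2) +
      z * (div_z (A v w) z * T 1 z ^ (d + 1) + R z) = 0"
    using R(2) eventually_neq_at_within[of 0]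
  proof eventually_elim
    case (elim z)
    then have "z * (div_z (B v w) z * T 1 z ^ (d + 2) +
      z * (div_z (A v w) z * T 1 z ^ (d + 1) + R z)) = 0"
      by (simp add: div_z_def algebra_simps power2_eq_square)
    then show ?case using elim by simp
  qed
  from isCont_zero_if_eventually_zero[OF _ this] have "div_z (B v w) 0 = 0"
    by (simp add: continuous_intros R(1) T T0 A1 B1)
  with A0 B0 show ?thesis by blast
qed

text \<open>Pulling back multiplies \<open>s\<close> by the new coordinate \<open>e\<close>, so
  division by \<open>e ^ d\<close> leaves \<open>1 / e\<close> at \<open>A\<close> and
  \<open>1 / e ^ 2\<close> at \<open>B\<close>. The order along the center makes \<open>A\<close>
  divisible by \<open>u\<close> and \<open>B\<close> by \<open>u ^ 2\<close>; the quotient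
  \<open>u / e\<close> has no pole and goes into \<open>u_excess\<close>.\<close>

lemma charted_blow_up_S:
  assumes ch: "charted d lo hi \<delta> A B H Q F" and ord: "ord_ge d F (center_S lo hi 0)"
  shows "charted d lo (hi + 1) \<delta> (\<lambda>v w. div_z (A v w)) (\<lambda>v w. div_z (div_z (B v w))) H Q
    (divide_exc (hi + 1) d (F \<circ> blow_down_S lo hi 0))"
proof -
  define A' where "A' = (\<lambda>v w. div_z (A v w))"
  define B' where "B' = (\<lambda>v w. div_z (div_z (B v w)))"
  define m where "m = d - 2"
  have d: "d = Suc (Suc m)" and lohi: "lo \<le> 0" "0 \<le> hi" "lo \<le> hi" and \<delta>: "\<delta> > 0"
    using ch by (auto simp: charted_def m_def)
  note vanish = coeffs_vanish_if_ord_ge[OF ch ord]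
  have hol: "A' v w holomorphic_on ball 0 \<delta>" "B' v w holomorphic_on ball 0 \<delta>"
    if "(v, w) \<noteq> (0, 0)" for v w
    unfolding A'_def B'_def using vanish[OF that] ch that
    by (auto simp: charted_def intro!: holomorphic_div_z)
  let ?e = "Ce (hi + 1)"
  have step: "F (blow_down_S lo hi 0 x) / x ?e ^ d = chart d lo (hi + 1) A' B' H Q x"
    if x: "(x Cv, x Cw) \<noteq> (0, 0)" "\<forall>p\<in>{lo..hi}. x (Ce p) \<noteq> 0" "x ?e \<noteq> 0"
      "norm (u_coord lo (hi + 1) x) < \<delta>" for x
  proof -
    let ?y = "blow_down_S lo hi 0 x"
    have scale: "ce_prod lo hi h ?y = ce_prod lo hi h x * x ?e ^ h hi" for h
      by (rule ce_prod_scale) (use lohi in \<open>auto simp: blow_down_S_def\<close>)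
    have yc: "?y Cv = x Cv" "?y Cw = x Cw" "?y Cs = x Cs * x ?e" "?y Ct = x Ct"
      by (auto simp: blow_down_S_def)
    have u: "u_coord lo hi ?y = u_coord lo (hi + 1) x"
      by (simp add: scale ce_prod_extend_hi[OF lohi(3)])
    \<comment> \<open>Exponentwise \<open>(hi - max p 0) + 1 = (hi + 1) - max p 0\<close>; the new
      coordinate has exponent 0 on both sides.\<close>
    have excess: "u_excess lo hi ?y * u_coord lo hi x = u_excess lo (hi + 1) x"
      using lohi unfolding scale ce_prod_extend_hi[OF lohi(3)]
      by (simp add: ce_prod_mult nat_add_distrib) (auto intro!: ce_prod_cong simp flip: power_Suc intro: arg_cong2[of _ _ _ _ power])
    have nat_hi: "nat (hi + 1) = Suc (nat hi)"
      using lohi by simp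
    have sf: "s_factor lo hi ?y * x ?e = s_factor lo (hi + 1) x"
      by (simp only: scale ce_prod_extend_hi[OF lohi(3)] nat_hi power_Suc) simp
    have tf: "t_factor lo hi ?y = t_factor lo (hi + 1) x"
      using lohi by (simp add: scale ce_prod_extend_hi[OF lohi(3)])
    have tt: "t_total lo hi Q ?y = t_total lo (hi + 1) Q x"
      unfolding t_total_def tf sf[symmetric] u yc by (simp add: algebra_simps)
    have F_eq: "F ?y = chart d lo hi A B H Q ?y"
    proof -
      have "?y (Ce p) \<noteq> 0" if "p \<in> {lo..<hi}" for p
        using x(2,3) that by (auto simp: blow_down_S_def)
      then show ?thesis
        using x(1,4) by (intro charted_eq[OF ch]) (simp_all only: yc u, blast+)
    qed
    define U where "U = u_coord lo (hi + 1) x"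
    have U: "U = u_coord lo hi x * x ?e"
      by (simp add: U_def ce_prod_extend_hi[OF lohi(3)])
    have AB: "A (x Cv) (x Cw) U = U * A' (x Cv) (x Cw) U"
      "B (x Cv) (x Cw) U = U * (U * B' (x Cv) (x Cw) U)"
      unfolding A'_def B'_def using vanish[OF x(1)] by (auto simp: mult_div_z)
    have "chart d lo hi A B H Q ?y / x ?e ^ d = chart d lo (hi + 1) A' B' H Q x"
    proof -
      define K where "K = u_excess lo hi ?y"
      define L where "L = u_coord lo hi x"
      define e where "e = x ?e"
      define P where "P = t_factor lo (hi + 1) x"
      have e: "e \<noteq> 0" using x(3) by (simp add: e_def)
      have KL: "u_excess lo (hi + 1) x = K * L"
        using excess by (simp add: K_def L_def)
      have ss: "?y Cs * s_factor lo hi ?y = x Cs * s_factor lo (hi + 1) x"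
        using sf by (simp add: yc mult_ac)
      have "chart d lo hi A B H Q ?y = e ^ d * chart d lo (hi + 1) A' B' H Q x"
        unfolding chart_def ss tt u tf K_def[symmetric] KL
        unfolding yc U_def[symmetric] e_def[symmetric] P_def[symmetric] AB d
        unfolding U L_def[symmetric] e_def[symmetric]
        by (simp add: algebra_simps power2_eq_square power_mult_distrib add_divide_distrib)
      then show ?thesis
        using e by (simp add: e_def)
    qed
    then show ?thesis
      by (simp only: F_eq)
  qed
  let ?F' = "divide_exc (hi + 1) d (F \<circ> blow_down_S lo hi 0)"
  have ch0: "charted d lo (hi + 1) \<delta> A' B' H Q (chart d lo (hi + 1) A' B' H Q)"
    using ch hol by (simp add: charted_def)
  have "?F' x = chart d lo (hi + 1) A' B' H Q x"
    if x: "(x Cv, x Cw) \<noteq> (0, 0)" "\<forall>p\<in>{lo..<hi + 1}. x (Ce p) \<noteq> 0"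
      "norm (u_coord lo (hi + 1) x) < \<delta>" for x
  proof (rule divide_exc_eq_chart[OF ch0 x])
    fix z :: complex
    assume z: "z \<noteq> 0" "norm (u_coord lo (hi + 1) (x(?e := z))) < \<delta>"
    have "F (blow_down_S lo hi 0 (x(?e := z))) / (x(?e := z)) ?e ^ d = chart d lo (hi + 1) A' B' H Q (x(?e := z))"
      by (rule step[OF _ _ _ z(2)]) (use x(1,2) z(1) in auto)
    then have eq: "F (blow_down_S lo hi 0 (x(?e := z))) / z ^ d = chart d lo (hi + 1) A' B' H Q (x(?e := z))"
      by (simp only: fun_upd_same)
    show "(F \<circ> blow_down_S lo hi 0) (x(?e := z)) / z ^ d = chart d lo (hi + 1) A' B' H Q (x(?e := z))"
      unfolding o_apply by (rule eq)
  qed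
  then show ?thesis
    using ch0 unfolding A'_def B'_def charted_def by blast
qed


section \<open>Base change and induction along the chain\<close>

text \<open>The grading bounds the exponent of \<open>t\<close> by \<open>d + 2\<close>, so only
  \<open>s ^ (d - 1)\<close> and \<open>s ^ (d - 2)\<close> occur below \<open>s ^ d\<close>. For
  \<open>lo = hi = 0\<close> the factors \<open>s_factor\<close>, \<open>t_factor\<close>,
  \<open>u_excess\<close> are 1, and with \<open>Q = 0\<close> the chart is just this expansion in
  \<open>s\<close>.\<close>

lemma charted_base_change:
  assumes f: "f \<in> family_sections n D (d * 2) (d * (2 + n))" and n: "n \<ge> 5" and d: "2 \<le> d" "d \<le> 6"
    and D: "open D" "0 \<in> D" and K: "K \<ge> 1"
  shows "\<exists>\<delta> A B H Q. charted d 0 0 \<delta> A B H Q (\<lambda>x. f (x(Ce 0 := x (Ce 0) ^ K)))"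
proof -
  obtain c where c: "\<And>i j k l. c i j k l holomorphic_on D"
    and f_eq: "f = (\<lambda>x. \<Sum>(i, j, k, l)\<in>monomials n (d * 2) (d * (2 + n)).
                  c i j k l (x (Ce 0)) * x Cs ^ i * x Ct ^ j * x Cv ^ k * x Cw ^ l)"
    using f by (auto simp: family_sections_def)
  obtain \<epsilon> where \<epsilon>: "\<epsilon> > 0" "ball 0 \<epsilon> \<subseteq> D"
    using D openE by blast
  \<comment> \<open>A radius at most 1 gives \<open>norm (u ^ K) \<le> norm u\<close>, so the base
    change maps the small disk into \<open>D\<close>.\<close>
  define \<delta> where "\<delta> = min \<epsilon> 1"
  have \<delta>: "\<delta> > 0"
    using \<epsilon> by (simp add: \<delta>_def)
  have cK: "(\<lambda>u. c i j k l (u ^ K)) holomorphic_on ball 0 \<delta>" for i j k l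
  proof -
    have "u ^ K \<in> D" if "u \<in> ball 0 \<delta>" for u :: complex
    proof -
      have "norm u ^ K \<le> norm u ^ 1"
        using that K by (intro power_decreasing) (auto simp: \<delta>_def)
      then show ?thesis
        using that \<epsilon>(2) by (auto simp: \<delta>_def norm_power)
    qed
    then have "(\<lambda>u. u ^ K) ` ball 0 \<delta> \<subseteq> D"
      by (rule image_subsetI)
    moreover have "(\<lambda>u. u ^ K) holomorphic_on ball 0 \<delta>"
      by (intro holomorphic_intros)
    ultimately show ?thesis
      using holomorphic_on_compose_gen[of "\<lambda>u. u ^ K" "ball 0 \<delta>" "c i j k l" D] c
      by (simp add: o_def)
  qed
  define M where "M = monomials n (d * 2) (d * (2 + n))"
  define Md where "Md = (\<lambda>e. {m \<in> M. fst m = e})"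
  define Mh where "Mh = {m \<in> M. fst m \<ge> d}"
  define C where "C = (\<lambda>e v w u. \<Sum>(i, j, k, l)\<in>Md e. c i j k l (u ^ K) * v ^ k * w ^ l)"
  define H where "H = (\<lambda>s t v w u. \<Sum>(i, j, k, l)\<in>Mh. c i j k l (u ^ K) * s ^ (i - d) * t ^ j * v ^ k * w ^ l)"
  have fin: "finite M"
    by (simp add: M_def finite_monomials)
  \<comment> \<open>A smaller exponent of \<open>s\<close> forces \<open>j \<ge> d + 3\<close>; then
    \<open>n * (d + 3) \<le> d * (2 + n)\<close>, i.e. \<open>3 * n \<le> 2 * d \<le> 12\<close>,
    against \<open>n \<ge> 5\<close>.\<close>
  have low: "fst m \<ge> d - 2" if "m \<in> M" for m
  proof (rule ccontr)
    obtain i j k l where m: "m = (i, j, k, l)"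
      by (cases m)
    assume "\<not> d - 2 \<le> fst m"
    with that m have ij: "i + j = d * 2" "n * j + k + l = d * (2 + n)" "j \<ge> d + 3"
      by (auto simp: M_def monomials_def)
    have "n * (d + 3) \<le> n * j"
      using ij(3) by (rule mult_le_mono2)
    then have "3 * n \<le> 2 * d"
      using ij(2) by (simp add: algebra_simps)
    then show False
      using n d by simp
  qed
  have M_split: "M = Md (d - 2) \<union> (Md (d - 1) \<union> Mh)"
    using low by (force simp: Md_def Mh_def)
  have sum_split: "(\<Sum>m\<in>M. h m) = (\<Sum>m\<in>Md (d - 2). h m) + ((\<Sum>m\<in>Md (d - 1). h m) + (\<Sum>m\<in>Mh. h m))"
    for h :: "_ \<Rightarrow> complex"
    unfolding M_split using d fin
    by (subst sum.union_disjoint; (subst sum.union_disjoint)?) (auto simp: Md_def Mh_def)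
  have H: "jointly_holomorphic \<delta> H"
    unfolding jointly_holomorphic_def H_def case_prod_beta
    by (intro allI impI analytic_intros analytic_at_compose_ball[OF cK])
  have Q: "jointly_holomorphic \<delta> (\<lambda>s t v w u. 0)"
    by (simp add: jointly_holomorphic_def)
  have C: "C e v w holomorphic_on ball 0 \<delta>" for e v w
    unfolding C_def case_prod_beta by (intro holomorphic_intros cK)
  have "f (x(Ce 0 := x (Ce 0) ^ K)) = chart d 0 0 (C (d - 1)) (C (d - 2)) H (\<lambda>v w u. 0) x" for x
  proof -
    have cep: "ce_prod 0 0 h x = x (Ce 0) ^ h 0" for h
      by (simp add: ce_prod_def)
    let ?h = "\<lambda>(i, j, k, l). c i j k l (x (Ce 0) ^ K) * x Cs ^ i * x Ct ^ j * x Cv ^ k * x Cw ^ l"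
    have "(\<Sum>m\<in>Md e. ?h m) = C e (x Cv) (x Cw) (x (Ce 0)) * x Cs ^ e * x Ct ^ (2 * d - e)" for e
      unfolding C_def sum_distrib_right
    proof (rule sum.cong[OF refl])
      fix m
      assume "m \<in> Md e"
      then obtain j k l where m: "m = (e, j, k, l)" and "e + j = d * 2"
        by (cases m) (auto simp: Md_def M_def monomials_def)
      then have "j = 2 * d - e"
        by simp
      with m show "?h m = (case m of (i, j, k, l) \<Rightarrow> c i j k l (x (Ce 0) ^ K) * x Cv ^ k * x Cw ^ l) *
          x Cs ^ e * x Ct ^ (2 * d - e)"
        by simp
    qed
    moreover have "(\<Sum>m\<in>Mh. ?h m) = x Cs ^ d * H (x Cs) (x Ct) (x Cv) (x Cw) (x (Ce 0))"
      unfolding H_def sum_distrib_left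
      by (rule sum.cong) (auto simp: Mh_def M_def monomials_def mult_ac simp flip: power_add)
    moreover have "2 * d - (d - 2) = d + 2" "2 * d - (d - 1) = d + 1"
      using d by auto
    ultimately show ?thesis
      unfolding f_eq M_def[symmetric] using sum_split[of ?h]
      by (simp add: chart_def cep t_total_def)
  qed
  then have "charted d 0 0 \<delta> (C (d - 1)) (C (d - 2)) H (\<lambda>v w u. 0) (\<lambda>x. f (x(Ce 0 := x (Ce 0) ^ K)))"
    using \<delta> d H Q C by (simp add: charted_def)
  then show ?thesis by blast
qed

text \<open>\<open>f\<close> and \<open>g\<close> are followed separately with \<open>d = 4\<close>
  and \<open>d = 6\<close>: each time \<open>d\<close> is both the order along the blown-up curve
  and the power divided out. For \<open>n > 0\<close> the curve of class \<open>S\<close> is unique,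
  so \<open>c = 0\<close>.\<close>

lemma chain_model_charted:
  assumes "chain_model n f g lo hi F G" "n \<ge> 5" "open D" "0 \<in> D"
    "f \<in> family_sections n D (4 * 2) (4 * (2 + n))" "g \<in> family_sections n D (6 * 2) (6 * (2 + n))"
  shows "(\<exists>\<delta> A B H Q. charted 4 lo hi \<delta> A B H Q F) \<and> (\<exists>\<delta> A B H Q. charted 6 lo hi \<delta> A B H Q G)"
  using assms(1)
proof (induction rule: chain_model.induct)
  case (base_change k)
  then show ?case
    using charted_base_change[OF assms(5) assms(2) _ _ assms(3,4)]
      charted_base_change[OF assms(6) assms(2) _ _ assms(3,4)] by simp
next
  case (blow_up_S lo hi F G c)
  then have "c = 0" "ord_ge 4 F (center_S lo hi 0)" "ord_ge 6 G (center_S lo hi 0)"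
    using assms(2) by (auto simp: nonminimal_def)
  with blow_up_S.IH show ?case
    using charted_blow_up_S by blast
next
  case (blow_up_T lo hi F G q)
  then show ?case
    using charted_blow_up_T[OF _ blow_up_T.hyps(2)] by blast
qed

section \<open>The last component\<close>

text \<open>The lowest terms are in turn \<open>4 * b1 ^ 3 * s ^ 6\<close>,
  \<open>27 * b2 ^ 2 * s ^ 8\<close>, \<open>4 * a1 ^ 3 * s ^ 9\<close> and
  \<open>27 * a2 ^ 2 * s ^ 10\<close>. Their orders differ, so each coefficient must vanish once the
  earlier ones do.\<close>

lemma discr_coeffs_vanish:
  fixes a1 b1 a2 b2 :: complex and T1 T2 R1 R2 :: "complex \<Rightarrow> complex"
  assumes cont: "isCont T1 0" "isCont T2 0" "isCont R1 0" "isCont R2 0" and T: "T1 0 = 1" "T2 0 = 1"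
    and eq: "\<And>s. 4 * (a1 * s ^ 3 * T1 s ^ 5 + b1 * s ^ 2 * T1 s ^ 6 + s ^ 4 * R1 s) ^ 3 +
      27 * (a2 * s ^ 5 * T2 s ^ 7 + b2 * s ^ 4 * T2 s ^ 8 + s ^ 6 * R2 s) ^ 2 = 0"
  shows "a1 = 0 \<and> b1 = 0 \<and> a2 = 0 \<and> b2 = 0"
proof -
  have zero: "r 0 = 0" if "isCont r 0" "\<And>s. s ^ k * r s = 0" for r :: "complex \<Rightarrow> complex" and k
  proof (rule isCont_zero_if_eventually_zero[OF that(1)])
    have "r s = 0" if "s \<noteq> 0" for s
      using \<open>\<And>s. s ^ k * r s = 0\<close>[of s] that by simp
    then show "\<forall>\<^sub>F s in at 0. r s = 0"
      by (simp add: eventually_at_filter)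
  qed
  \<comment> \<open>\<open>?P\<close> and \<open>?Q\<close> are the quotients by
    \<open>s ^ 2\<close> and \<open>s ^ 4\<close>; \<open>?p\<close> and \<open>?q\<close> are what
    is left, one order higher, once \<open>b1\<close> and \<open>b2\<close> are zero.\<close>
  let ?p = "\<lambda>s. a1 * T1 s ^ 5 + s * R1 s" and ?q = "\<lambda>s. a2 * T2 s ^ 7 + s * R2 s"
  let ?P = "\<lambda>s. b1 * T1 s ^ 6 + s * ?p s" and ?Q = "\<lambda>s. b2 * T2 s ^ 8 + s * ?q s"
  have eq': "4 * (s ^ 2 * ?P s) ^ 3 + 27 * (s ^ 4 * ?Q s) ^ 2 = 0" for s
    using eq[of s] by (simp add: algebra_simps power_numeral_reduce)
  have "s ^ 6 * (4 * ?P s ^ 3 + 27 * s ^ 2 * ?Q s ^ 2) = 0" for s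
  proof -
    have "4 * (s ^ 2 * p) ^ 3 + 27 * (s ^ 4 * q) ^ 2 = s ^ 6 * (4 * p ^ 3 + 27 * s ^ 2 * q ^ 2)" for p q
      by algebra
    then show ?thesis
      using eq'[of s] by simp
  qed
  from zero[of "\<lambda>s. 4 * ?P s ^ 3 + 27 * s ^ 2 * ?Q s ^ 2", OF _ this] have b1: "b1 = 0"
    by (simp add: cont T continuous_intros)
  have eq1: "4 * (s ^ 3 * ?p s) ^ 3 + 27 * (s ^ 4 * ?Q s) ^ 2 = 0" for s
    using eq'[of s] by (simp add: b1 power_numeral_reduce mult_ac)
  have "s ^ 8 * (4 * s * ?p s ^ 3 + 27 * ?Q s ^ 2) = 0" for s
  proof -
    have "4 * (s ^ 3 * p) ^ 3 + 27 * (s ^ 4 * q) ^ 2 = s ^ 8 * (4 * s * p ^ 3 + 27 * q ^ 2)" for p q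
      by algebra
    then show ?thesis
      using eq1[of s] by simp
  qed
  from zero[of "\<lambda>s. 4 * s * ?p s ^ 3 + 27 * ?Q s ^ 2", OF _ this] have b2: "b2 = 0"
    by (simp add: cont T continuous_intros)
  have eq'': "4 * (s ^ 3 * ?p s) ^ 3 + 27 * (s ^ 5 * ?q s) ^ 2 = 0" for s
    using eq1[of s] by (simp add: b2 power_numeral_reduce mult_ac)
  have "s ^ 9 * (4 * ?p s ^ 3 + 27 * s * ?q s ^ 2) = 0" for s
  proof -
    have "4 * (s ^ 3 * p) ^ 3 + 27 * (s ^ 5 * q) ^ 2 = s ^ 9 * (4 * p ^ 3 + 27 * s * q ^ 2)" for p q
      by algebra
    then show ?thesis
      using eq''[of s] by simp
  qed
  from zero[of "\<lambda>s. 4 * ?p s ^ 3 + 27 * s * ?q s ^ 2", OF _ this] have a1: "a1 = 0"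
    by (simp add: cont T continuous_intros)
  have "s ^ 10 * (4 * s ^ 2 * R1 s ^ 3 + 27 * ?q s ^ 2) = 0" for s
  proof -
    have "4 * (s ^ 3 * (s * p)) ^ 3 + 27 * (s ^ 5 * q) ^ 2 = s ^ 10 * (4 * s ^ 2 * p ^ 3 + 27 * q ^ 2)" for p q
      by algebra
    then show ?thesis
      using eq''[of s] by (simp add: a1)
  qed
  from zero[of "\<lambda>s. 4 * s ^ 2 * R1 s ^ 3 + 27 * ?q s ^ 2", OF _ this] have "a2 = 0"
    by (simp add: cont T continuous_intros)
  with a1 b1 b2 show ?thesis by blast
qed

lemma embed_in_component:
  assumes "lo < hi" "x Ct \<noteq> 0" "(x Cv, x Cw) \<noteq> (0, 0)"
  shows "embed lo hi hi x \<in> component lo hi hi"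
  using assms by (auto simp: component_def chain_point_def embed_def)

text \<open>Here \<open>u = 0\<close>, while \<open>u_excess\<close> and \<open>t_factor\<close> are
  1, since \<open>Ce hi\<close> has exponent 0 in both and the other \<open>Ce q\<close> are 1.
  Hence \<open>A\<close> and \<open>B\<close> at \<open>u = 0\<close> control the two lowest orders
  in \<open>s\<close>.\<close>

lemma charted_on_last_component:
  assumes ch: "charted d lo hi \<delta> A B H Q F" and "lo < hi" and vw: "(v, w) \<noteq> (0, 0)"
  shows "\<exists>T R. isCont T 0 \<and> isCont R 0 \<and> T 0 = 1 \<and>
    (\<forall>s. F (embed lo hi hi (\<lambda>c. case c of Cs \<Rightarrow> s | Ct \<Rightarrow> 1 | Cv \<Rightarrow> v | Cw \<Rightarrow> w | Ce q \<Rightarrow> 1)) =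
       A v w 0 * s ^ (d - 1) * T s ^ (d + 1) + B v w 0 * s ^ (d - 2) * T s ^ (d + 2) + s ^ d * R s)"
proof -
  define X :: "complex \<Rightarrow> point" where
    "X = (\<lambda>s. embed lo hi hi (\<lambda>c. case c of Cs \<Rightarrow> s | Ct \<Rightarrow> 1 | Cv \<Rightarrow> v | Cw \<Rightarrow> w | Ce q \<Rightarrow> 1))"
  have Xc: "X s Cs = s" "X s Ct = 1" "X s Cv = v" "X s Cw = w" "X s (Ce q) = (if q = hi then 0 else 1)"
    for s q
    using \<open>lo < hi\<close> by (auto simp: X_def embed_def)
  have cep: "ce_prod lo hi h (X s) = 0 ^ h hi" for h s
    using ce_prod_single[of hi lo hi "X s" h] \<open>lo < hi\<close> by (simp add: Xc)
  have X: "(\<lambda>s. X s c) analytic_on {a}" for c a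
    by (cases c) (auto simp: Xc intro!: analytic_intros)
  have \<delta>: "\<delta> > 0" and hi: "hi \<ge> 0" and H: "jointly_holomorphic \<delta> H"
    using ch by (auto simp: charted_def)
  have T: "(\<lambda>s. t_total lo hi Q (X s)) analytic_on {0}"
    by (rule analytic_t_total[OF ch X]) (use \<delta> in \<open>simp add: cep\<close>)
  have R: "(\<lambda>s. H (X s Cs * s_factor lo hi (X s)) (t_total lo hi Q (X s)) (X s Cv) (X s Cw)
        (u_coord lo hi (X s))) analytic_on {0}"
    by (intro jointly_holomorphicD[OF H] analytic_intros X T) (use \<delta> in \<open>simp add: cep\<close>)
  \<comment> \<open>The factor \<open>0 ^ nat hi\<close> is 1 if \<open>hi = 0\<close> and 0
    otherwise, so both cases are covered.\<close>
  have R': "isCont (\<lambda>s. H (s * 0 ^ nat hi) (t_total lo hi Q (X s)) v w 0) 0"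
    using analytic_at_imp_isCont[OF R] by (simp add: Xc cep)
  have Xs: "embed lo hi hi (\<lambda>c. case c of Cs \<Rightarrow> s | Ct \<Rightarrow> 1 | Cv \<Rightarrow> v | Cw \<Rightarrow> w | Ce q \<Rightarrow> 1) = X s" for s
    by (simp add: X_def)
  have F_eq: "F (X s) = chart d lo hi A B H Q (X s)" for s
    by (rule charted_eq[OF ch]) (use vw \<delta> in \<open>auto simp: Xc cep\<close>)
  have T0: "t_total lo hi Q (X 0) = 1"
    using hi by (simp add: t_total_def Xc cep)
  show ?thesis
    unfolding Xs
    by (rule exI[of _ "\<lambda>s. t_total lo hi Q (X s)"],
        rule exI[of _ "\<lambda>s. H (s * 0 ^ nat hi) (t_total lo hi Q (X s)) v w 0"])
       (use hi in \<open>simp add: analytic_at_imp_isCont[OF T] R' F_eq T0 chart_def Xc cep\<close>)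
qed

text \<open>Without \<open>A\<close> and \<open>B\<close> the chart is \<open>s ^ d\<close> times an
  analytic cofactor, and \<open>s\<close> is a multiple of \<open>z\<close> on every line through a
  point of the curve. As the line may move \<open>(v, w)\<close>, the vanishing is applied at each
  nearby \<open>z\<close>.\<close>

lemma ord_ge_last_component:
  assumes ch: "charted d lo hi \<delta> A B H Q F" and "lo < hi"
    and vanish: "\<And>v w. (v, w) \<noteq> (0, 0) \<Longrightarrow> A v w 0 = 0 \<and> B v w 0 = 0"
  shows "ord_ge d (F \<circ> embed lo hi hi) (locus (\<lambda>x. x Cs))"
  unfolding ord_ge_def multiplicity_ge_def
proof (intro ballI allI impI)
  fix x y :: point and j
  assume "x \<in> locus (\<lambda>x. x Cs)" and j: "j < d"
  then have x: "x Cs = 0" "x Ct \<noteq> 0" "(x Cv, x Cw) \<noteq> (0, 0)"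
    by (auto simp: locus_def hirzebruch_point_def)
  define X where "X = (\<lambda>z. embed lo hi hi (\<lambda>c. x c + z * y c))"
  have Xc: "X z Cs = z * y Cs" "X z Cv = x Cv + z * y Cv" "X z Cw = x Cw + z * y Cw" for z
    by (simp_all add: X_def embed_def x(1))
  have X: "(\<lambda>z. X z c) analytic_on {a}" for c a
  proof (cases c)
    case (Ce q)
    then show ?thesis
      using \<open>lo < hi\<close> unfolding X_def embed_def
      by (cases "q = hi"; cases "q = hi - 1") (auto intro!: analytic_intros)
  qed (use \<open>lo < hi\<close> in \<open>auto simp: X_def embed_def intro!: analytic_intros\<close>)
  have \<delta>: "\<delta> > 0" and hi: "hi \<ge> 0" and d: "d \<ge> 2" and H: "jointly_holomorphic \<delta> H"
    using ch by (auto simp: charted_def)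
  have u0: "u_coord lo hi (X z) = 0" for z
    using \<open>lo < hi\<close> by (auto simp: ce_prod_eq_0_iff X_def embed_def intro!: bexI[of _ hi])
  have small: "norm (u_coord lo hi (X 0)) < \<delta>"
    using \<delta> by (simp only: u0 norm_zero)
  have ev_nz: "\<forall>\<^sub>F z in nhds 0. x c + z * y c \<noteq> 0" if "x c \<noteq> 0" for c
  proof -
    have "((\<lambda>z. x c + z * y c) \<longlongrightarrow> x c + 0 * y c) (nhds 0)"
      by (intro tendsto_add tendsto_mult_right tendsto_const filterlim_ident)
    then show ?thesis
      using that by (intro tendsto_imp_eventually_ne) auto
  qed
  have ev_vw: "\<forall>\<^sub>F z in nhds 0. (X z Cv, X z Cw) \<noteq> (0, 0)"
  proof (cases "x Cv = 0")
    case True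
    then show ?thesis
      using ev_nz[of Cw] x(3) by (auto simp: Xc elim: eventually_mono)
  next
    case False
    then show ?thesis
      using ev_nz[of Cv] by (auto simp: Xc elim: eventually_mono)
  qed
  \<comment> \<open>On this component \<open>t\<close> plays the role of \<open>Ce (hi - 1)\<close>,
    and the coordinates before it are 1.\<close>
  have nz: "\<forall>p\<in>{lo..<hi}. X z (Ce p) \<noteq> 0" if "x Ct + z * y Ct \<noteq> 0" for z
    using that by (auto simp: X_def embed_def)
  define \<psi> where "\<psi> = (\<lambda>z. y Cs ^ d * H (X z Cs * s_factor lo hi (X z)) (t_total lo hi Q (X z))
    (X z Cv) (X z Cw) (u_coord lo hi (X z)) / t_factor lo hi (X z) ^ d)"
  have "\<psi> analytic_on {0}"
    unfolding \<psi>_def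
    by (intro analytic_intros jointly_holomorphicD[OF H] X analytic_t_total[OF ch X])
       (use t_factor_nonzero[OF hi nz[of 0]] x small in auto)
  moreover have "\<forall>\<^sub>F z in nhds 0. F (X z) = z ^ d * \<psi> z"
    using ev_vw ev_nz[OF x(2)]
  proof eventually_elim
    case (elim z)
    have "F (X z) = chart d lo hi A B H Q (X z)"
      by (rule charted_eq[OF ch elim(1) nz[OF elim(2)]]) (use \<delta> in \<open>simp only: u0 norm_zero\<close>)
    then show ?case
      unfolding chart_def u0 using vanish[OF elim(1)]
      by (simp add: \<psi>_def Xc u0[simplified] power_mult_distrib)
  qed
  ultimately show "(deriv ^^ j) (\<lambda>z. (F \<circ> embed lo hi hi) (\<lambda>c. x c + z * y c)) 0 = 0"
    using higher_deriv_zero_if_power_mult[of \<psi> _ d j] j by (simp add: X_def)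
qed

section \<open>Irreducibility of the negative curve\<close>

definition fn_point :: "complex \<Rightarrow> complex \<Rightarrow> complex \<Rightarrow> complex \<Rightarrow> point" where
  "fn_point s t v w = (\<lambda>c. case c of Cs \<Rightarrow> s | Ct \<Rightarrow> t | Cv \<Rightarrow> v | Cw \<Rightarrow> w | Ce q \<Rightarrow> 0)"

text \<open>The two torus actions on the Cox coordinates recover the class: this one reads off
  \<open>b\<close>, and \<open>sections_scale_base\<close> reads off \<open>a\<close>.\<close>

lemma sections_scale_fiber:
  assumes "F \<in> sections n a b"
  shows "F (fn_point s (\<mu> ^ n * t) (\<mu> * v) (\<mu> * w)) = \<mu> ^ b * F (fn_point s t v w)"
  using assms unfolding sections_def fn_point_def
  by (auto simp: sum_distrib_left monomials_def power_mult_distrib power_add power_mult intro!: sum.cong)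

lemma sections_scale_base:
  assumes "F \<in> sections n a b"
  shows "F (fn_point (\<mu> * s) (\<mu> * t) v w) = \<mu> ^ a * F (fn_point s t v w)"
  using assms unfolding sections_def fn_point_def
  by (auto simp: sum_distrib_left monomials_def power_mult_distrib power_add intro!: sum.cong)

text \<open>Evaluating a factorization of \<open>s\<close> at \<open>(s, 0, 0, 0)\<close> and
  scaling shows that the classes of the factors add up to \<open>(1, 0)\<close>, so one of them is
  \<open>(0, 0)\<close>.\<close>

lemma irreducible_negative_curve:
  assumes "n > 0"
  shows "irreducible_curve n 1 0 (\<lambda>x. x Cs)"
proof -
  have "monomials n 1 0 = {(1, 0, 0, 0)}"
    using assms by (auto simp: monomials_def)
  then have "(\<lambda>x. x Cs) \<in> sections n 1 0"
    by (auto simp: sections_def intro!: exI[of _ "\<lambda>_ _ _ _. 1"])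
  moreover have "(\<lambda>x :: point. x Cs) \<noteq> (\<lambda>x. 0)"
    by (auto dest!: fun_cong[of _ _ "\<lambda>_. 1"])
  moreover have "(a1, b1) = (0, 0) \<or> (a2, b2) = (0, 0)"
    if G: "G \<in> sections n a1 b1" and H: "H \<in> sections n a2 b2" and GH: "(\<lambda>x. x Cs) = (\<lambda>x. G x * H x)"
    for a1 b1 a2 b2 G H
  proof -
    \<comment> \<open>These points do not represent points of \<open>F_n\<close>, but the
      factorization is an identity of functions on all of \<open>point\<close>.\<close>
    have s: "s = G (fn_point s 0 0 0) * H (fn_point s 0 0 0)" for s
      using fun_cong[OF GH, of "fn_point s 0 0 0"] by (simp add: fn_point_def)
    have pow: "e = e'" if "(2 :: complex) ^ e = 2 ^ e'" for e e' :: nat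
    proof -
      have "(2 :: nat) ^ e = 2 ^ e'"
        using that by (metis of_nat_eq_iff of_nat_numeral of_nat_power)
      then show ?thesis by simp
    qed
    have GH_scale: "G (fn_point 1 0 0 0) = 2 ^ b1 * G (fn_point 1 0 0 0)"
      "H (fn_point 1 0 0 0) = 2 ^ b2 * H (fn_point 1 0 0 0)"
      by (rule sections_scale_fiber[OF G, of 1 2 0 0 0, unfolded mult_zero_right]
          sections_scale_fiber[OF H, of 1 2 0 0 0, unfolded mult_zero_right])+
    have "1 = G (fn_point 1 0 0 0) * H (fn_point 1 0 0 0)"
      by (rule s)
    also have "\<dots> = (2 ^ b1 * G (fn_point 1 0 0 0)) * (2 ^ b2 * H (fn_point 1 0 0 0))"
      by (rule arg_cong2[of _ _ _ _ "(*)", OF GH_scale])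
    also have "\<dots> = 2 ^ (b1 + b2) * (G (fn_point 1 0 0 0) * H (fn_point 1 0 0 0))"
      by (simp add: power_add)
    finally have b: "b1 + b2 = 0"
      using s[of 1] by (intro pow) simp
    have "2 = (2 ^ a1 * G (fn_point 1 0 0 0)) * (2 ^ a2 * H (fn_point 1 0 0 0))"
      using s[of 2] sections_scale_base[OF G, of 2 1 0 0 0] sections_scale_base[OF H, of 2 1 0 0 0]
      by simp
    also have "\<dots> = 2 ^ (a1 + a2) * (G (fn_point 1 0 0 0) * H (fn_point 1 0 0 0))"
      by (simp add: power_add)
    finally have "a1 + a2 = 1"
      using s[of 1] by (intro pow) simp
    with b show ?thesis by auto
  qed
  ultimately show ?thesis
    unfolding irreducible_curve_def by auto
qed

section \<open>Contradiction for \<open>n \<ge> 5\<close>\<close>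

theorem mainTheorem2:
  fixes n :: nat
  assumes "0 \<le> n" and "n \<le> 12"
    and "\<exists>D f g. horizontal_model n D f g \<and> class_1_to_4 n f g \<and> type_III_b n f g"
  shows "0 \<le> n \<and> n \<le> 4"
proof (rule ccontr)
  assume "\<not> (0 \<le> n \<and> n \<le> 4)"
  then have n: "n \<ge> 5" by simp
  obtain D f g where hor: "horizontal_model n D f g" and "type_III_b n f g"
    using assms(3) by blast
  then obtain lo hi F G N where res: "open_chain_resolution n f g lo hi F G N"
    and "lo < hi" and N: "\<forall>p\<in>{lo..hi}. N p > 0"
    unfolding type_III_b_def by fastforce
  have "open D" "0 \<in> D" "f \<in> family_sections n D (4 * 2) (4 * (2 + n))"
    "g \<in> family_sections n D (6 * 2) (6 * (2 + n))"
    using hor by (auto simp: horizontal_model_def)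
  moreover have "chain_model n f g lo hi F G"
    using res by (simp add: open_chain_resolution_def)
  ultimately obtain \<delta>1 A1 B1 H1 Q1 \<delta>2 A2 B2 H2 Q2 where
    F: "charted 4 lo hi \<delta>1 A1 B1 H1 Q1 F" and G: "charted 6 lo hi \<delta>2 A2 B2 H2 Q2 G"
    using chain_model_charted n by meson
  have "ord_ge (N hi) (discr F G) (component lo hi hi)"
    using res \<open>lo < hi\<close> by (auto simp: open_chain_resolution_def kodaira_I_def)
  \<comment> \<open>As \<open>N hi > 0\<close>, the multiplicity condition includes
    \<open>j = 0\<close>, which is the vanishing of the value itself.\<close>
  then have discr: "discr F G x = 0" if "x \<in> component lo hi hi" for x
    using that N \<open>lo < hi\<close> by (fastforce simp: ord_ge_def multiplicity_ge_def dest: spec[of _ 0])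
  have vanish: "A1 v w 0 = 0 \<and> B1 v w 0 = 0 \<and> A2 v w 0 = 0 \<and> B2 v w 0 = 0"
    if vw: "(v, w) \<noteq> (0, 0)" for v w
  proof -
    obtain T1 R1 T2 R2 where
      cont: "isCont T1 0" "isCont T2 0" "isCont R1 0" "isCont R2 0" and T: "T1 0 = 1" "T2 0 = 1"
      and eq: "\<And>s. F (embed lo hi hi (\<lambda>c. case c of Cs \<Rightarrow> s | Ct \<Rightarrow> 1 | Cv \<Rightarrow> v | Cw \<Rightarrow> w | Ce q \<Rightarrow> 1)) =
         A1 v w 0 * s ^ 3 * T1 s ^ 5 + B1 v w 0 * s ^ 2 * T1 s ^ 6 + s ^ 4 * R1 s"
      "\<And>s. G (embed lo hi hi (\<lambda>c. case c of Cs \<Rightarrow> s | Ct \<Rightarrow> 1 | Cv \<Rightarrow> v | Cw \<Rightarrow> w | Ce q \<Rightarrow> 1)) =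
         A2 v w 0 * s ^ 5 * T2 s ^ 7 + B2 v w 0 * s ^ 4 * T2 s ^ 8 + s ^ 6 * R2 s"
      using charted_on_last_component[OF F \<open>lo < hi\<close> vw] charted_on_last_component[OF G \<open>lo < hi\<close> vw]
      by auto
    show ?thesis
    proof -
      have "4 * (A1 v w 0 * s ^ 3 * T1 s ^ 5 + B1 v w 0 * s ^ 2 * T1 s ^ 6 + s ^ 4 * R1 s) ^ 3 +
        27 * (A2 v w 0 * s ^ 5 * T2 s ^ 7 + B2 v w 0 * s ^ 4 * T2 s ^ 8 + s ^ 6 * R2 s) ^ 2 = 0" for s
        unfolding eq[symmetric] discr_def[symmetric]
        by (intro discr embed_in_component \<open>lo < hi\<close>) (use vw in auto)
      from discr_coeffs_vanish[OF cont T this] show ?thesis by blast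
    qed
  qed
  \<comment> \<open>Orders \<open>(4, 6)\<close> along the \<open>(-n)\<close>-curve of the last
    component are what \<open>infinite_distance_free\<close> forbids.\<close>
  have "ord_ge 4 (F \<circ> embed lo hi hi) (locus (\<lambda>x. x Cs))"
    "ord_ge 6 (G \<circ> embed lo hi hi) (locus (\<lambda>x. x Cs))"
    using ord_ge_last_component[OF F \<open>lo < hi\<close>] ord_ge_last_component[OF G \<open>lo < hi\<close>] vanish by blast+
  moreover have "irreducible_curve n 1 0 (\<lambda>x. x Cs)"
    using n by (intro irreducible_negative_curve) simp
  moreover have "hi \<in> {lo..hi}"
    using \<open>lo < hi\<close> by simp
  ultimately have "\<not> infinite_distance_free n lo hi F G"
    unfolding infinite_distance_free_def by blast
  then show False
    using res by (simp add: open_chain_resolution_def)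
qed

end
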